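(* Let $m\in\tfrac12\mathbb{Z}_{>0}$. (a) If $s,s_1\in\mathbb{Z}$ and $s',s_1'\in\tfrac12+\mathbb{Z}$, then $\tilde\Phi^{+[m;s]}(-\tfrac1\tau,\tfrac{z_1}{\tau},\tfrac{z_2}{\tau})=\tau e^{\frac{2\pi i m}{\tau}z_1z_2}\tilde\Phi^{+[m;s_1]}(\tau,z_1,z_2)$, $\tilde\Phi^{-[m;s]}(-\tfrac1\tau,\tfrac{z_1}{\tau},\tfrac{z_2}{\tau})=\tau e^{\frac{2\pi i m}{\tau}z_1z_2}\tilde\Phi^{+[m;s']}(\tau,z_1,z_2)$, $\tilde\Phi^{+[m;s']}(-\tfrac1\tau,\tfrac{z_1}{\tau},\tfrac{z_2}{\tau})=\tau e^{\frac{2\pi i m}{\tau}z_1z_2}\tilde\Phi^{-[m;s]}(\tau,z_1,z_2)$, $\tilde\Phi^{-[m;s']}(-\tfrac1\tau,\tfrac{z_1}{\tau},\tfrac{z_2}{\tau})=\tau e^{\frac{2\pi i m}{\tau}z_1z_2}\tilde\Phi^{-[m;s_1']}(\tau,z_1,z_2)$. (b) If $s,s'\in\tfrac12\mathbb{Z}$ satisfy $m+s\in\mathbb{Z}$ and $m+s'\in\tfrac12+\mathbb{Z}$, then $\tilde\Phi^{\pm[m;s]}(\tau+1,z_1,z_2)=\tilde\Phi^{\pm[m;s]}(\tau,z_1,z_2)$ and $\tilde\Phi^{\pm[m;s']}(\tau+1,z_1,z_2)=\tilde\Phi^{\mp[m;s']}(\tau,z_1,z_2)$. (c) If $s\in\tfrac12\mathbb{Z}$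 and either $a,b\in\mathbb{Z}$ have the same parity, or $m\in\mathbb{Z}_{>0}$ and $a,b\in\mathbb{Z}$, then $\tilde\Phi^{\pm[m;s]}(\tau,z_1+a\tau,z_2+b\tau)=(\pm1)^a e^{-2\pi i m(bz_1+az_2)}q^{-mab}\tilde\Phi^{\pm[m;s]}(\tau,z_1,z_2)$ and $\tilde\Phi^{\pm[m;s]}(\tau,z_1+a,z_2+b)=e^{2\pi i sa}\tilde\Phi^{\pm[m;s]}(\tau,z_1,z_2)$. (d) If $m\notin\mathbb{Z}$, $s\in\tfrac12\mathbb{Z}$ and $a,b\in\mathbb{Z}$ have different parity, then $\tilde\Phi^{\pm[m;s]}(\tau,z_1+a\tau,z_2+b\tau)=(\pm1)^a e^{-2\pi i m(bz_1+az_2)}q^{-mab}\tilde\Phi^{\pm[m;s+\frac12]}(\tau,z_1,z_2)$ and $\tilde\Phi^{\pm[m;s]}(\tau,z_1+a,z_2+b)=e^{2\pi i sa}\tilde\Phi^{\mp[m;s]}(\tau,z_1,z_2)$.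
   Context: Throughout, $\operatorname{Im}\tau>0$, $q=e^{2\pi i\tau}$, $z_1,z_2\in\mathbb{C}$, and in each formula the sign $\pm$ is the same on both sides (with $\mp$ meaning the opposite sign). For $m\in\tfrac12\mathbb{Z}_{>0}$, $s,j\in\tfrac12\mathbb{Z}$ define $$\Phi^{\pm[m;s]}(\tau,z_1,z_2)=\sum_{n\in\mathbb{Z}}(\pm1)^n\frac{e^{2\pi i mn(z_1+z_2)+2\pi i s z_1}q^{mn^2+sn}}{1-e^{2\pi i z_1}q^n},\qquad \Theta^{\pm}_{j,m}(\tau,z)=\sum_{n\in\mathbb{Z}}(\pm1)^ne^{2\pi i m z(n+\frac{j}{2m})}q^{m(n+\frac{j}{2m})^2},$$ $$R^{\pm}_{j,m}(\tau,z)=\sum_{n\in\frac12\mathbb{Z},\ n\equiv j\bmod 2m}(\pm1)^{\frac{n-j}{2m}}\Big\{\operatorname{sign}(n-\tfrac12-j+2m)-E\big(\psi_{m,n}(\tau,z)\big)\Big\}e^{-\frac{\pi i n^2}{2m}\tau+2\pi i n z},$$ where $E(x)=2\int_0^xe^{-\pi u^2}du$ and $\psi_{m,n}(\tau,z)=\big(n-2m\frac{\operatorname{Im}z}{\operatorname{Im}\tau}\big)\sqrt{\frac{\operatorname{Im}\tau}{m}}$. The modifier is $\Phi^{\pm[m;s]}_{\rm add}(\tau,z_1,z_2)=\sum_{j\in s+\mathbb{Z},\ s\le j<s+2m}R^{\pm}_{j,m}\big(\tau,\tfrac{z_1-z_2}2\big)\Theta^{\pm}_{j,m}(\tau,z_1+z_2)$,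 and the modified functions are $\tilde\Phi^{\pm[m;s]}=\Phi^{\pm[m;s]}-\tfrac12\Phi^{\pm[m;s]}_{\rm add}$. *)

theory Defs
  imports "HOL-Analysis.Analysis"
begin

definition ee :: "complex \<Rightarrow> complex" where
  "ee x = exp (2 * complex_of_real pi * \<i> * x)"

definition qp :: "complex \<Rightarrow> complex \<Rightarrow> complex" where
  "qp \<tau> x = exp (2 * complex_of_real pi * \<i> * \<tau> * x)"

text \<open>Phi^{eps[m;s]}(tau,z1,z2); eps = 1 or -1 encodes the sign\<close>
definition Phi :: "complex \<Rightarrow> real \<Rightarrow> real \<Rightarrow> complex \<Rightarrow> complex \<Rightarrow> complex \<Rightarrow> complex" where
  "Phi \<epsilon> m s \<tau> z1 z2 =
     (\<Sum>\<^sub>\<infinity>n::int. \<epsilon> powi n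
        * ee (of_real m * of_int n * (z1 + z2) + of_real s * z1)
        * qp \<tau> (of_real m * of_int n ^ 2 + of_real s * of_int n)
        / (1 - ee z1 * qp \<tau> (of_int n)))"

definition Theta :: "complex \<Rightarrow> real \<Rightarrow> real \<Rightarrow> complex \<Rightarrow> complex \<Rightarrow> complex" where
  "Theta \<epsilon> j m \<tau> z =
     (\<Sum>\<^sub>\<infinity>n::int. \<epsilon> powi n
        * ee (of_real m * z * of_real (of_int n + j / (2 * m)))
        * qp \<tau> (of_real (m * (of_int n + j / (2 * m)) ^ 2)))"

definition EE :: "real \<Rightarrow> real" where
  "EE x = 2 * (if 0 \<le> x then integral {0..x} (\<lambda>u. exp (- pi * u ^ 2))
               else - integral {x..0} (\<lambda>u. exp (- pi * u ^ 2)))"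

definition psi :: "real \<Rightarrow> real \<Rightarrow> complex \<Rightarrow> complex \<Rightarrow> real" where
  "psi m n \<tau> z = (n - 2 * m * Im z / Im \<tau>) * sqrt (Im \<tau> / m)"

definition R :: "complex \<Rightarrow> real \<Rightarrow> real \<Rightarrow> complex \<Rightarrow> complex \<Rightarrow> complex" where
  "R \<epsilon> j m \<tau> z =
     (\<Sum>\<^sub>\<infinity>n\<in>{n::real. 2 * n \<in> \<int> \<and> (n - j) / (2 * m) \<in> \<int>}.
        \<epsilon> powi \<lfloor>(n - j) / (2 * m)\<rfloor>
        * complex_of_real (sgn (n - 1/2 - j + 2 * m) - EE (psi m n \<tau> z))
        * exp (- complex_of_real pi * \<i> * of_real (n ^ 2) / of_real (2 * m) * \<tau>
               + 2 * complex_of_real pi * \<i> * of_real n * z))"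

definition Phi_add :: "complex \<Rightarrow> real \<Rightarrow> real \<Rightarrow> complex \<Rightarrow> complex \<Rightarrow> complex \<Rightarrow> complex" where
  "Phi_add \<epsilon> m s \<tau> z1 z2 =
     (\<Sum>j\<in>{j::real. j - s \<in> \<int> \<and> s \<le> j \<and> j < s + 2 * m}.
        R \<epsilon> j m \<tau> ((z1 - z2) / 2) * Theta \<epsilon> j m \<tau> (z1 + z2))"

definition tPhi :: "complex \<Rightarrow> real \<Rightarrow> real \<Rightarrow> complex \<Rightarrow> complex \<Rightarrow> complex \<Rightarrow> complex" where
  "tPhi \<epsilon> m s \<tau> z1 z2 = Phi \<epsilon> m s \<tau> z1 z2 - 1/2 * Phi_add \<epsilon> m s \<tau> z1 z2"

end

theory Submission
  imports Defs "HOL-Probability.Probability"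
begin

text \<open>
  With \<open>c = m / Im \<tau>\<close>, \<open>w = z1 + z2\<close> and \<open>\<delta> = cnj (z1 - z2)\<close>, the modified function is the lattice sum
  \<open>tPhi = - 1 / (2 \<pi> \<i>) \<Sum> \<epsilon>\<^sup>a ee (- s b) ee (- m a b) exp (- \<pi> c (l cnj l + w cnj l + \<delta> (z1 + l) + z1 z2)) / (z1 + l)\<close>
  over all \<open>l = a \<tau> + b\<close>. It converges absolutely, and every transformation law is a change of variables
  \<open>(a, b)\<close> in it: an element of \<open>SL(2,Z)\<close> for the modular laws, a translation for the elliptic ones.
  For fixed \<open>a\<close>, the sum over \<open>b\<close> equals the \<open>a\<close>-th summand of \<open>Phi\<close> minus half the \<open>a\<close>-th row of \<open>Phi_add\<close>;
  this is a consequence of Poisson summation for Gaussians.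
\<close>

section \<open>Gaussian tails and Gaussian sums\<close>

text \<open>The obstacle is that \<open>Phi\<close> and \<open>Phi_add\<close> are summed along rows
  \<open>a\<close> that single out the basis \<open>\<tau>, 1\<close> of the lattice, so inversion
  does not act visibly on either. A plain sum over \<open>b\<close> of characters divided by
  \<open>b + \<zeta>\<close> converges only conditionally; a Gaussian in \<open>b\<close> cures this
  and smooths the sign of \<open>k - \<eta>\<close> on the Poisson-dual side into \<open>EE\<close>.
  The width is thereby forced: the argument \<open>psi\<close> has the form
  \<open>(i - \<eta>) / sqrt c\<close> with \<open>c = m / Im \<tau>\<close> and
  \<open>\<eta> = c * Im (z1 - z2) - s\<close>. The other factors of the lattice term come from
  completing this square against the summand of \<open>Phi\<close>. Since \<open>2 * m\<close> and
  \<open>2 * s\<close> are integers, \<open>\<epsilon> powi a\<close> and \<open>ee (- s b)\<close>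
  are both sign characters of the lattice. Inversion exchanges them, which is why in (a) the sign
  trades places with the class of \<open>s\<close> modulo 1. The sign \<open>ee (- m a b)\<close> is
  quadratic in \<open>(a, b)\<close>; its deviation from a character gives the dependence on
  \<open>m + s\<close> in (b) and, together with the phase of the kernel, the dependence on the
  parity of \<open>a - b\<close> in (c) and (d).\<close>

lemma EE_has_real_derivative: "(EE has_real_derivative 2 * exp (- pi * x\<^sup>2)) (at x)"
proof -
  define g where "g = (\<lambda>u::real. exp (- pi * u\<^sup>2))"
  define N where "N = \<bar>x\<bar> + 1"
  have int: "g integrable_on {a..b}" for a b
    unfolding g_def by (intro integrable_continuous_interval continuous_intros)
  \<comment> \<open>Moving the base point from 0 to \<open>-N\<close> merges the two branches of
    \<open>EE\<close> into one integral with variable upper limit, so that no case distinction at 0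
    is left to differentiate.\<close>
  have eq: "EE y = 2 * (integral {-N..y} g - integral {-N..0} g)" if "y \<in> {-N<..}" for y
  proof (cases "0 \<le> y")
    case True
    have "integral {-N..0} g + integral {0..y} g = integral {-N..y} g"
      using True that int by (intro Henstock_Kurzweil_Integration.integral_combine) (auto simp: N_def)
    thus ?thesis using True by (simp add: EE_def g_def)
  next
    case False
    have "integral {-N..y} g + integral {y..0} g = integral {-N..0} g"
      using False that int by (intro Henstock_Kurzweil_Integration.integral_combine) (auto simp: N_def)
    thus ?thesis using False by (simp add: EE_def g_def)
  qed
  have "((\<lambda>y. integral {-N..y} g) has_real_derivative g x) (at x within {-N..x+1})"
    by (rule integral_has_real_derivative) (auto simp: g_def N_def intro!: continuous_intros)
  moreover have "at x within {-N..x+1} = at x"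
    by (rule at_within_interior) (auto simp: N_def)
  ultimately have "((\<lambda>y. integral {-N..y} g) has_real_derivative g x) (at x)" by simp
  hence "((\<lambda>y. 2 * (integral {-N..y} g - integral {-N..0} g)) has_real_derivative 2 * g x) (at x)"
    by (auto intro!: derivative_eq_intros)
  moreover have "eventually (\<lambda>y. y \<in> {-N<..}) (nhds x)"
    by (rule eventually_nhds_in_open) (auto simp: N_def)
  hence "eventually (\<lambda>y. EE y = 2 * (integral {-N..y} g - integral {-N..0} g)) (nhds x)"
    by eventually_elim (rule eq)
  ultimately show ?thesis
    by (subst DERIV_cong_ev[OF refl _ refl]) (auto simp: g_def)
qed

lemma EE_0 [simp]: "EE 0 = 0"
  by (simp add: EE_def)

lemma EE_minus: "EE (- x) = - EE x"
proof -
  have "\<exists>c. \<forall>x\<in>UNIV. EE (- x) + EE x = c"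
  proof (rule has_field_derivative_zero_constant)
    fix x :: real
    show "((\<lambda>x. EE (- x) + EE x) has_field_derivative 0) (at x within UNIV)"
      by (auto intro!: derivative_eq_intros DERIV_chain2[OF EE_has_real_derivative] EE_has_real_derivative)
  qed auto
  then obtain c where c: "EE (- x) + EE x = c" for x by auto
  from c[of 0] have "c = 0" by simp
  with c[of x] show ?thesis by simp
qed

lemma EE_mono: "x \<le> y \<Longrightarrow> EE x \<le> EE y"
  by (rule DERIV_nonneg_imp_nondecreasing) (auto intro: EE_has_real_derivative)

lemma EE_tendsto_1: "(EE \<longlongrightarrow> 1) at_top"
proof -
  \<comment> \<open>Scaling the half-line integral of \<open>exp (- x\<^sup>2)\<close>, which is
    \<open>sqrt pi / 2\<close>, by \<open>sqrt pi\<close> gives the value 1/2 that normalizes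
    \<open>EE\<close>.\<close>
  have "has_bochner_integral lborel (\<lambda>x. indicator {0..} (0 + sqrt pi * x) *\<^sub>R exp (- (0 + sqrt pi * x)\<^sup>2)) ((sqrt pi / 2) /\<^sub>R \<bar>sqrt pi\<bar>)"
    by (subst lborel_has_bochner_integral_real_affine_iff[symmetric]) (use gaussian_moment_0 in auto)
  also have "(\<lambda>x. indicator {0..} (0 + sqrt pi * x) *\<^sub>R exp (- (0 + sqrt pi * x)\<^sup>2)) =
     (\<lambda>x. indicator {0..} x *\<^sub>R exp (- pi * x\<^sup>2))"
    using pi_gt_zero by (auto simp: fun_eq_iff indicator_def power_mult_distrib zero_le_mult_iff simp del: pi_gt_zero)
  finally have *: "has_bochner_integral lborel (\<lambda>x. indicator {0..} x *\<^sub>R exp (- pi * x\<^sup>2)) (1/2 :: real)"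
    by simp
  have int: "set_integrable lborel {0..} (\<lambda>x. exp (- pi * x\<^sup>2))"
    using * by (auto simp: set_integrable_def has_bochner_integral_iff)
  have "((\<lambda>b. LINT x:{0..b}|lborel. exp (- pi * x\<^sup>2)) \<longlongrightarrow> (LINT x:{0..}|lborel. exp (- pi * x\<^sup>2))) at_top"
    by (rule tendsto_set_lebesgue_integral_at_top) (use int in auto)
  also have "(LINT x:{0..}|lborel. exp (- pi * x\<^sup>2)) = 1/2"
    using * by (simp add: set_lebesgue_integral_def has_bochner_integral_iff)
  finally have "((\<lambda>b. 2 * (LINT x:{0..b}|lborel. exp (- pi * x\<^sup>2))) \<longlongrightarrow> 2 * (1/2)) at_top"
    by (intro tendsto_mult tendsto_const)
  moreover have "eventually (\<lambda>b. 2 * (LINT x:{0..b}|lborel. exp (- pi * x\<^sup>2)) = EE b) at_top"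
    using eventually_ge_at_top[of 0]
  proof eventually_elim
    case (elim b)
    have "set_integrable lborel {0..b} (\<lambda>x. exp (- pi * x\<^sup>2))"
      by (rule set_integrable_subset[OF int]) auto
    thus ?case using elim by (simp add: EE_def set_borel_integral_eq_integral)
  qed
  ultimately show ?thesis by (simp add: tendsto_cong)
qed

lemma EE_le_1: "EE x \<le> 1"
proof (rule tendsto_lowerbound[OF EE_tendsto_1])
  show "\<forall>\<^sub>F y in at_top. EE x \<le> EE y"
    using eventually_ge_at_top[of x] by eventually_elim (rule EE_mono)
qed auto

lemma abs_EE_le_1: "\<bar>EE x\<bar> \<le> 1"
  using EE_le_1[of x] EE_le_1[of "-x"] by (simp add: EE_minus abs_le_iff)

text \<open>For \<open>t \<ge> x \<ge> 0\<close> one has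
  \<open>t\<^sup>2 \<ge> x\<^sup>2 + (t - x)\<^sup>2\<close>, so the Gaussian mass beyond
  \<open>x\<close> is at most \<open>exp (- pi * x\<^sup>2)\<close> times the mass beyond 0. The
  function \<open>\<psi>\<close> expresses this comparison on a finite interval; then
  \<open>y\<close> tends to infinity.\<close>

lemma one_minus_EE_le:
  assumes "x \<ge> 0"
  shows   "1 - EE x \<le> exp (- pi * x\<^sup>2)"
proof -
  have 1: "EE y - EE x \<le> exp (- pi * x\<^sup>2)" if "y \<ge> x" for y
  proof -
    define \<psi> where "\<psi> = (\<lambda>y. exp (- pi * x\<^sup>2) * EE (y - x) - EE y)"
    have "\<psi> x \<le> \<psi> y"
    proof (rule DERIV_nonneg_imp_nondecreasing[OF that])
      fix t assume t: "x \<le> t" "t \<le> y"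
      have "(\<psi> has_real_derivative exp (- pi * x\<^sup>2) * (2 * exp (- pi * (t - x)\<^sup>2)) - 2 * exp (- pi * t\<^sup>2)) (at t)"
        unfolding \<psi>_def
        by (auto intro!: derivative_eq_intros DERIV_chain2[OF EE_has_real_derivative] EE_has_real_derivative)
      moreover have "x\<^sup>2 + (t - x)\<^sup>2 \<le> t\<^sup>2"
        using t assms mult_nonneg_nonneg[of x "t - x"] by (simp add: power2_eq_square algebra_simps)
      hence "pi * (x\<^sup>2 + (t - x)\<^sup>2) \<le> pi * t\<^sup>2" by (intro mult_left_mono) auto
      hence "exp (- pi * t\<^sup>2) \<le> exp (- pi * x\<^sup>2) * exp (- pi * (t - x)\<^sup>2)"
        by (simp add: mult_exp_exp ring_distribs)
      ultimately show "\<exists>D. (\<psi> has_real_derivative D) (at t) \<and> D \<ge> 0" by force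
    qed
    hence "EE y - EE x \<le> exp (- pi * x\<^sup>2) * EE (y - x)" by (simp add: \<psi>_def)
    also have "\<dots> \<le> exp (- pi * x\<^sup>2) * 1"
      by (intro mult_left_mono EE_le_1) auto
    finally show ?thesis by simp
  qed
  have "((\<lambda>y. EE y - EE x) \<longlongrightarrow> 1 - EE x) at_top"
    by (intro tendsto_intros EE_tendsto_1)
  thus ?thesis
    by (rule tendsto_upperbound) (use 1 in \<open>auto intro: eventually_mono[OF eventually_ge_at_top[of x]]\<close>)
qed

text \<open>The jump is at \<open>k = 0\<close>, not at \<open>k = \<eta>\<close>; the mismatch only costs a constant.\<close>

lemma abs_sign_minus_EE_le:
  fixes k :: int and \<eta> c :: real
  assumes "c > 0"
  shows "\<bar>(if k \<ge> 0 then 1 else -1) - EE ((of_int k - \<eta>) / sqrt c)\<bar>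
           \<le> 2 * exp (pi * \<eta>\<^sup>2 / c) * exp (- pi * (of_int k - \<eta>)\<^sup>2 / c)"
proof -
  define x where "x = (of_int k - \<eta>) / sqrt c"
  have x2: "pi * x\<^sup>2 = pi * (of_int k - \<eta>)\<^sup>2 / c"
    using assms by (simp add: x_def power_divide)
  have e1: "exp (pi * \<eta>\<^sup>2 / c) \<ge> 1" using assms by simp
  have same: "\<bar>(if k \<ge> 0 then 1 else -1) - EE x\<bar> \<le> exp (- pi * x\<^sup>2)" if "k \<ge> 0 \<longleftrightarrow> x \<ge> 0"
    using that one_minus_EE_le[of x] one_minus_EE_le[of "-x"] EE_le_1[of x] EE_le_1[of "-x"]
    by (auto simp: EE_minus abs_le_iff)
  show ?thesis
  proof (cases "k \<ge> 0 \<longleftrightarrow> x \<ge> 0")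
    case True
    have "\<bar>(if k \<ge> 0 then 1 else -1) - EE x\<bar> \<le> 1 * exp (- pi * x\<^sup>2)" using same[OF True] by simp
    also have "\<dots> \<le> (2 * exp (pi * \<eta>\<^sup>2 / c)) * exp (- pi * x\<^sup>2)"
      using e1 by (intro mult_right_mono) (linarith, simp)
    finally show ?thesis using x2 by (simp add: x_def)
  next
    case False
    \<comment> \<open>In the mismatched case \<open>k\<close> lies between 0 and
      \<open>\<eta>\<close>. The factor \<open>exp (pi * \<eta>\<^sup>2 / c)\<close> then outweighs
      the Gaussian, and the trivial bound 2 suffices.\<close>
    have "\<bar>of_int k - \<eta>\<bar> \<le> \<bar>\<eta>\<bar>"
      using False assms by (auto simp: x_def zero_le_divide_iff divide_le_0_iff not_le)
    hence "(of_int k - \<eta>)\<^sup>2 \<le> \<eta>\<^sup>2" by (simp add: abs_le_square_iff)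
    hence "pi * (of_int k - \<eta>)\<^sup>2 / c \<le> pi * \<eta>\<^sup>2 / c"
      using assms by (intro divide_right_mono mult_left_mono) auto
    hence "1 \<le> exp (pi * \<eta>\<^sup>2 / c) * exp (- pi * (of_int k - \<eta>)\<^sup>2 / c)"
      by (simp add: mult_exp_exp)
    moreover have "\<bar>(if k \<ge> 0 then 1 else -1) - EE x\<bar> \<le> 2"
      using abs_EE_le_1[of x] by (auto simp: abs_le_iff)
    ultimately show ?thesis by (simp add: x_def)
  qed
qed

section \<open>Gaussian majorants over integers and pairs of integers\<close>

lemma summable_on_int_exp_neg_abs: "(\<lambda>k::int. exp (- \<bar>of_int k\<bar> :: real)) summable_on UNIV"
proof -
  have s: "summable (\<lambda>n. norm (exp (- 1 :: real) ^ n))" by (simp add: summable_geometric)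
  hence n: "(\<lambda>n. exp (- 1 :: real) ^ n) summable_on (UNIV :: nat set)"
    using norm_summable_imp_summable_on by blast
  have n': "(\<lambda>n. exp (- real n)) summable_on (UNIV :: nat set)"
    using n by (simp add: exp_of_nat_mult[symmetric])
  have "(\<lambda>k::int. exp (- \<bar>of_int k\<bar> :: real)) summable_on range int"
    by (subst summable_on_reindex) (use n' in \<open>auto simp: o_def\<close>)
  moreover have "(\<lambda>k::int. exp (- \<bar>of_int k\<bar> :: real)) summable_on range (\<lambda>n. - int n)"
    by (subst summable_on_reindex) (use n' in \<open>auto simp: o_def inj_on_def\<close>)
  ultimately have "(\<lambda>k::int. exp (- \<bar>of_int k\<bar> :: real)) summable_on (range int \<union> range (\<lambda>n. - int n))"
    by (rule summable_on_union)
  also have "range int \<union> range (\<lambda>n. - int n) = UNIV"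
  proof (intro equalityI subsetI)
    fix k :: int
    show "k \<in> range int \<union> range (\<lambda>n. - int n)"
    proof (cases "k \<ge> 0")
      case True thus ?thesis by (intro UnI1 image_eqI[of _ _ "nat k"]) auto
    next
      case False thus ?thesis by (intro UnI2 image_eqI[of _ _ "nat (-k)"]) auto
    qed
  qed auto
  finally show ?thesis .
qed

text \<open>Completing the square with slope \<open>\<beta> + 1\<close> in place of
  \<open>\<beta>\<close> leaves a spare \<open>- t\<close>, which makes the Gaussian comparable to a
  geometric series.\<close>

lemma quadratic_le_linear:
  fixes \<alpha> \<beta> t :: real
  assumes "\<alpha> > 0"
  shows "- \<alpha> * t\<^sup>2 + \<beta> * t \<le> (\<beta> + 1)\<^sup>2 / (4 * \<alpha>) - t"
proof -
  have "(2 * \<alpha> * t - (\<beta> + 1))\<^sup>2 / (4 * \<alpha>) \<ge> 0" using assms by simp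
  also have "(2 * \<alpha> * t - (\<beta> + 1))\<^sup>2 / (4 * \<alpha>) = \<alpha> * t\<^sup>2 - \<beta> * t - t + (\<beta> + 1)\<^sup>2 / (4 * \<alpha>)"
    using assms by (simp add: field_simps power2_eq_square)
  finally show ?thesis by simp
qed

lemma summable_on_int_gaussian:
  fixes \<alpha> \<beta> :: real
  assumes "\<alpha> > 0"
  shows "(\<lambda>k::int. exp (- \<alpha> * (of_int k)\<^sup>2 + \<beta> * \<bar>of_int k\<bar>)) summable_on UNIV"
proof (rule summable_on_comparison_test)
  show "(\<lambda>k::int. exp ((\<beta> + 1)\<^sup>2 / (4 * \<alpha>)) * exp (- \<bar>of_int k\<bar> :: real)) summable_on UNIV"
    by (intro summable_on_cmult_right summable_on_int_exp_neg_abs)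
  fix k :: int
  show "exp (- \<alpha> * (of_int k)\<^sup>2 + \<beta> * \<bar>of_int k\<bar>) \<le> exp ((\<beta> + 1)\<^sup>2 / (4 * \<alpha>)) * exp (- \<bar>of_int k\<bar> :: real)"
    using quadratic_le_linear[OF assms, of "\<bar>of_int k\<bar>" \<beta>] by (simp add: mult_exp_exp)
qed auto

text \<open>The common shape of all majorants below: the term \<open>\<beta> * \<bar>k\<bar>\<close>
  absorbs every shift of the centre and every imaginary part, so only the quadratic part has to be
  examined.\<close>

lemma summable_on_int_gaussian_bound:
  fixes f :: "int \<Rightarrow> 'a :: banach" and \<alpha> \<beta> C :: real
  assumes "\<alpha> > 0" "\<And>k. norm (f k) \<le> C * exp (- \<alpha> * (of_int k)\<^sup>2 + \<beta> * \<bar>of_int k\<bar>)"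
  shows "f summable_on UNIV"
proof (rule abs_summable_summable, rule Infinite_Sum.abs_summable_on_comparison_test')
  show "(\<lambda>k::int. C * exp (- \<alpha> * (of_int k)\<^sup>2 + \<beta> * \<bar>of_int k\<bar>)) summable_on UNIV"
    by (intro summable_on_cmult_right summable_on_int_gaussian assms)
qed (use assms in auto)

lemma summable_on_int_pair_gaussian_bound:
  fixes f :: "int \<times> int \<Rightarrow> 'a :: banach" and \<alpha> \<beta> C :: real
  assumes "\<alpha> > 0"
  assumes "\<And>a b. norm (f (a, b)) \<le> C * exp (- \<alpha> * ((of_int a)\<^sup>2 + (of_int b)\<^sup>2) + \<beta> * (\<bar>of_int a\<bar> + \<bar>of_int b\<bar>))"
  shows "f summable_on UNIV"
proof (rule abs_summable_summable, rule Infinite_Sum.abs_summable_on_comparison_test')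
  define g where "g = (\<lambda>k::int. exp (- \<alpha> * (of_int k)\<^sup>2 + \<beta> * \<bar>of_int k\<bar>) :: real)"
  have g: "g summable_on UNIV" unfolding g_def by (intro summable_on_int_gaussian assms)
  have "(\<lambda>x. norm (case x of (a, b) \<Rightarrow> g a * g b)) summable_on (UNIV \<times> UNIV)"
    unfolding Infinite_Sum.abs_summable_on_Sigma_iff
    using g by (auto simp: abs_mult infsum_cmult_right' infsum_cmult_left' summable_on_iff_abs_summable_on_real[symmetric]
                   intro!: summable_on_cmult_right summable_on_cmult_left) (auto simp: g_def)
  hence "(\<lambda>(a, b). g a * g b) summable_on UNIV"
    using abs_summable_summable by fastforce
  thus "(\<lambda>x. C * (case x of (a, b) \<Rightarrow> g a * g b)) summable_on UNIV"
    by (intro summable_on_cmult_right)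
  fix x :: "int \<times> int"
  show "norm (f x) \<le> C * (case x of (a, b) \<Rightarrow> g a * g b)"
    using assms(2)[of "fst x" "snd x"]
    by (simp add: g_def mult_exp_exp case_prod_unfold algebra_simps)
qed

text \<open>By the M-test the net of finite partial sums converges uniformly, so continuity and the
  integral pass to the limit. Working with that net instead of a sequence gives the unconditional
  \<open>has_sum\<close> directly.\<close>

lemma has_sum_integral:
  fixes f :: "'i \<Rightarrow> real \<Rightarrow> complex"
  assumes cont: "\<And>i. continuous_on {a..b} (f i)"
  assumes le: "\<And>i x. x \<in> {a..b} \<Longrightarrow> norm (f i x) \<le> M i"
  assumes M: "M summable_on UNIV"
  shows "continuous_on {a..b} (\<lambda>x. \<Sum>\<^sub>\<infinity>i. f i x)"
    and "((\<lambda>i. integral {a..b} (f i)) has_sum integral {a..b} (\<lambda>x. \<Sum>\<^sub>\<infinity>i. f i x)) UNIV"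
proof -
  have ul: "uniform_limit {a..b} (\<lambda>X x. \<Sum>i\<in>X. f i x) (\<lambda>x. \<Sum>\<^sub>\<infinity>i. f i x) (finite_subsets_at_top UNIV)"
    by (rule Weierstrass_m_test_general) (use le M in auto)
  show "continuous_on {a..b} (\<lambda>x. \<Sum>\<^sub>\<infinity>i. f i x)"
    by (rule uniform_limit_theorem[OF _ ul]) (auto intro!: always_eventually continuous_intros cont)
  obtain I J where I: "\<And>X. ((\<lambda>x. \<Sum>i\<in>X. f i x) has_integral I X) {a..b}"
      and J: "((\<lambda>x. \<Sum>\<^sub>\<infinity>i. f i x) has_integral J) {a..b}"
      and lim: "(I \<longlongrightarrow> J) (finite_subsets_at_top UNIV)"
    by (rule uniform_limit_integral[OF ul]) (auto intro!: continuous_intros cont)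
  have "I X = (\<Sum>i\<in>X. integral {a..b} (f i))" if "finite X" for X
  proof -
    have "((\<lambda>x. \<Sum>i\<in>X. f i x) has_integral (\<Sum>i\<in>X. integral {a..b} (f i))) {a..b}"
      using that by (intro has_integral_sum) (auto intro!: integrable_integral integrable_continuous_interval cont)
    thus ?thesis using I has_integral_unique by blast
  qed
  hence "eventually (\<lambda>X. I X = (\<Sum>i\<in>X. integral {a..b} (f i))) (finite_subsets_at_top UNIV)"
    by (auto intro!: eventually_finite_subsets_at_top_weakI)
  with lim have "((\<lambda>X. \<Sum>i\<in>X. integral {a..b} (f i)) \<longlongrightarrow> J) (finite_subsets_at_top UNIV)"
    using tendsto_cong by fast
  thus "((\<lambda>i. integral {a..b} (f i)) has_sum integral {a..b} (\<lambda>x. \<Sum>\<^sub>\<infinity>i. f i x)) UNIV"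
    using J by (simp add: has_sum_def integral_unique)
qed

section \<open>Uniqueness of Fourier coefficients\<close>

lemma ee_add: "ee (x + y) = ee x * ee y"
  by (simp add: ee_def ring_distribs exp_add)

lemma ee_diff: "ee (x - y) = ee x / ee y"
  by (simp add: ee_def ring_distribs exp_diff)

lemma ee_minus: "ee (- x) = inverse (ee x)"
  by (simp add: ee_def exp_minus)

lemma ee_0 [simp]: "ee 0 = 1"
  by (simp add: ee_def)

lemma ee_nonzero [simp]: "ee x \<noteq> 0"
  by (simp add: ee_def)

lemma norm_ee: "norm (ee x) = exp (- 2 * pi * Im x)"
  by (simp add: ee_def norm_exp_eq_Re)

lemma ee_eq_1_iff: "ee x = 1 \<longleftrightarrow> x \<in> \<int>"
proof -
  have "ee x = 1 \<longleftrightarrow> Im x = 0 \<and> (\<exists>n::int. Re x = of_int n)"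
    unfolding ee_def exp_eq_1 by (auto simp: mult.commute)
  also have "\<dots> \<longleftrightarrow> (\<exists>n::int. x = of_int n)"
    by (auto simp: complex_eq_iff)
  finally show ?thesis by (auto simp: Ints_def)
qed

lemma ee_Ints: "x \<in> \<int> \<Longrightarrow> ee x = 1"
  by (simp add: ee_eq_1_iff)

lemma ee_of_int [simp]: "ee (of_int n) = 1"
  by (simp add: ee_Ints)

lemma continuous_on_ee [continuous_intros]: "continuous_on A f \<Longrightarrow> continuous_on A (\<lambda>x. ee (f x))"
  unfolding ee_def by (intro continuous_intros)

lemma cnj_ee_of_real: "cnj (ee (of_real x)) = ee (- of_real x)"
  by (simp add: ee_def exp_cnj)

text \<open>On the unit circle \<open>cnj z\<close> is the inverse of \<open>z\<close>, so a
  real-linear function of \<open>z\<close> is a combination of \<open>z\<close> and its inverse, and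
  multiplying by it only moves the Fourier index by one. The induction keeps \<open>f\<close> and
  \<open>n\<close> arbitrary because the product case applies the hypothesis for \<open>p\<close> to
  \<open>q\<close> times \<open>f\<close>.\<close>

lemma fourier_coeffs_zero_mult_polynomial:
  assumes "real_polynomial_function p"
  assumes "continuous_on {0..1} f"
  assumes "\<And>n::int. integral {0..1} (\<lambda>x. f x * ee (of_int n * of_real x)) = 0"
  shows "integral {0..1} (\<lambda>x. of_real (p (ee (of_real x))) * f x * ee (of_int n * of_real x)) = 0"
  using assms
proof (induction arbitrary: f n rule: real_polynomial_function.induct)
  case (linear p)
  interpret p: bounded_linear p by fact
  \<comment> \<open>The coefficients of \<open>z\<close> and \<open>cnj z\<close> in the real-linear
    map determined by \<open>p 1\<close> and \<open>p \<i>\<close>.\<close>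
  define \<alpha> where "\<alpha> = (of_real (p 1) - \<i> * of_real (p \<i>)) / 2"
  define \<beta> where "\<beta> = (of_real (p 1) + \<i> * of_real (p \<i>)) / 2"
  have p: "of_real (p (ee (of_real x))) = \<alpha> * ee (of_real x) + \<beta> * ee (- of_real x)" for x :: real
  proof -
    define z where "z = ee (of_real x)"
    have "p z = p (Re z *\<^sub>R 1 + Im z *\<^sub>R \<i>)"
      by (intro arg_cong[of _ _ p]) (simp add: complex_eq_iff)
    also have "\<dots> = Re z * p 1 + Im z * p \<i>"
      by (simp only: p.add p.scaleR) simp
    finally have "of_real (p z) = \<alpha> * z + \<beta> * cnj z"
      by (simp add: \<alpha>_def \<beta>_def complex_eq_iff field_simps)
    thus ?thesis by (simp add: z_def cnj_ee_of_real)
  qed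
  have int: "(\<lambda>x. f x * ee (of_int k * of_real x)) integrable_on {0..1}" for k :: int
    by (intro integrable_continuous_interval continuous_intros linear)
  have "integral {0..1} (\<lambda>x. of_real (p (ee (of_real x))) * f x * ee (of_int n * of_real x)) =
        integral {0..1} (\<lambda>x. \<alpha> * (f x * ee (of_int (n + 1) * of_real x)) + \<beta> * (f x * ee (of_int (n - 1) * of_real x)))"
    unfolding p by (intro integral_cong) (simp add: algebra_simps ee_add ee_diff ee_minus field_simps)
  also have "\<dots> = \<alpha> * integral {0..1} (\<lambda>x. f x * ee (of_int (n + 1) * of_real x))
                + \<beta> * integral {0..1} (\<lambda>x. f x * ee (of_int (n - 1) * of_real x))"
    by (subst integral_add) (use int[of "n+1"] int[of "n-1"] in \<open>auto intro!: integrable_on_mult_right\<close>)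
  also have "\<dots> = 0" unfolding linear.prems(2) by simp
  finally show ?case .
next
  case (const c)
  thus ?case by (simp add: mult.assoc)
next
  case (add p q)
  have "continuous_on UNIV p" "continuous_on UNIV q"
    using add.hyps by (auto intro: continuous_real_polymonial_function continuous_at_imp_continuous_on)
  hence "continuous_on {0..1} (\<lambda>x. p (ee (of_real x)))" "continuous_on {0..1} (\<lambda>x. q (ee (of_real x)))"
    by (auto intro!: continuous_on_compose2[of UNIV p] continuous_on_compose2[of UNIV q] continuous_intros)
  hence "(\<lambda>x. of_real (p (ee (of_real x))) * f x * ee (of_int n * of_real x)) integrable_on {0..1}"
        "(\<lambda>x. of_real (q (ee (of_real x))) * f x * ee (of_int n * of_real x)) integrable_on {0..1}"
    by (auto intro!: integrable_continuous_interval continuous_intros add.prems)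
  from integral_add[OF this] show ?case
    using add by (simp add: ring_distribs)
next
  case (mult p q)
  have "continuous_on UNIV q"
    using mult.hyps by (auto intro: continuous_real_polymonial_function continuous_at_imp_continuous_on)
  hence "continuous_on {0..1} (\<lambda>x. q (ee (of_real x)))"
    by (auto intro!: continuous_on_compose2[of UNIV q] continuous_intros)
  hence "continuous_on {0..1} (\<lambda>x. of_real (q (ee (of_real x))) * f x)"
    by (auto intro!: continuous_intros mult.prems)
  from mult.IH(1)[OF this] mult.IH(2)[OF mult.prems] show ?case
    by (simp add: mult_ac)
qed

text \<open>Stone-Weierstrass on the circle gives a polynomial \<open>g\<close> close to
  \<open>cnj f\<close>. As \<open>g * f\<close> integrates to 0, the integral of
  \<open>(norm f)\<^sup>2\<close> equals that of \<open>(cnj f - g) * f\<close>, which is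
  arbitrarily small.\<close>

lemma fourier_coeffs_zero_imp_zero:
  fixes f :: "real \<Rightarrow> complex"
  assumes cont: "continuous_on {0..1} f" and per: "f 0 = f 1"
  assumes zero: "\<And>n::int. integral {0..1} (\<lambda>x. f x * ee (of_int n * of_real x)) = 0"
  assumes x: "x \<in> {0..1}"
  shows "f x = 0"
proof -
  define F where "F = (\<lambda>x. cnj (f x)) \<circ> (\<lambda>z. Arg2pi z / (2 * pi))"
  \<comment> \<open>The trivial homotopy of the loop with itself carries over to circle maps, and
    this yields continuity of \<open>F\<close> even at 1, where \<open>Arg2pi\<close> jumps.\<close>
  have "homotopic_loops UNIV (\<lambda>x. cnj (f x)) (\<lambda>x. cnj (f x))"
    using cont per by (auto simp: homotopic_loops_refl path_def pathfinish_def pathstart_def intro!: continuous_intros)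
  from homotopic_loops_imp_homotopic_circlemaps[OF this] have contF: "continuous_on (sphere 0 1) F"
    unfolding F_def using homotopic_with_imp_continuous by blast
  have F: "F (ee (of_real x)) = cnj (f x)" if "x \<in> {0..1}" for x
  proof (cases "x = 1")
    case True
    have "ee 1 = 1" using ee_of_int[of 1] by simp
    moreover have "Arg2pi 1 = 0" by (rule Arg2pi_unique[of 1]) auto
    ultimately show ?thesis using True per by (simp add: F_def)
  next
    case False
    have "Arg2pi (ee (of_real x)) = 2 * pi * x"
      by (rule Arg2pi_unique[of 1]) (use False that in \<open>auto simp: ee_def mult_ac\<close>)
    thus ?thesis by (simp add: F_def)
  qed
  define I where "I = integral {0..1} (\<lambda>x. (norm (f x))\<^sup>2)"
  define J where "J = integral {0..1} (\<lambda>x. norm (f x))"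
  have cf2: "continuous_on {0..1} (\<lambda>x. (norm (f x))\<^sup>2)" by (intro continuous_intros cont)
  have cf1: "continuous_on {0..1} (\<lambda>x. norm (f x))" by (intro continuous_intros cont)
  have J: "J \<ge> 0" unfolding J_def by (rule integral_nonneg) (auto intro!: integrable_continuous_interval cf1)
  have bound: "\<bar>I\<bar> \<le> e * J" if e: "e > 0" for e
  proof -
    obtain g where g: "polynomial_function g" "\<And>z. z \<in> sphere 0 1 \<Longrightarrow> norm (F z - g z) < e"
      using Stone_Weierstrass_polynomial_function[OF compact_sphere contF e] by blast
    have "real_polynomial_function (Re \<circ> g)" "real_polynomial_function (Im \<circ> g)"
      using g(1) bounded_linear_Re bounded_linear_Im unfolding polynomial_function_def by blast+
    note * = fourier_coeffs_zero_mult_polynomial[OF this(1) cont zero, of 0]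
             fourier_coeffs_zero_mult_polynomial[OF this(2) cont zero, of 0]
    have "continuous_on UNIV g"
      using g(1) by (auto intro: continuous_polymonial_function continuous_at_imp_continuous_on)
    hence cg: "continuous_on {0..1} (\<lambda>x. g (ee (of_real x)))"
      by (auto intro!: continuous_on_compose2[of UNIV g] continuous_intros)
    have "integral {0..1} (\<lambda>x. g (ee (of_real x)) * f x) =
       integral {0..1} (\<lambda>x. of_real (Re (g (ee (of_real x)))) * f x + \<i> * (of_real (Im (g (ee (of_real x)))) * f x))"
      by (intro integral_cong) (simp add: complex_eq_iff algebra_simps)
    also have "\<dots> = 0"
      using * cg by (subst integral_add) (auto intro!: integrable_continuous_interval continuous_intros cont)
    finally have gz: "integral {0..1} (\<lambda>x. g (ee (of_real x)) * f x) = 0" .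
    have "of_real I = integral {0..1} (\<lambda>x. of_real ((norm (f x))\<^sup>2) :: complex)"
      unfolding I_def using integrable_continuous_interval[OF cf2]
      by (intro integral_unique[symmetric] has_integral_of_real integrable_integral)
    also have "\<dots> = integral {0..1} (\<lambda>x. (cnj (f x) - g (ee (of_real x))) * f x + g (ee (of_real x)) * f x)"
      by (intro integral_cong) (simp add: algebra_simps complex_norm_square del: of_real_power)
    also have "\<dots> = integral {0..1} (\<lambda>x. (cnj (f x) - g (ee (of_real x))) * f x)"
      by (subst integral_add) (use gz in \<open>auto intro!: integrable_continuous_interval continuous_intros cont cg\<close>)
    finally have "\<bar>I\<bar> = norm (integral {0..1} (\<lambda>x. (cnj (f x) - g (ee (of_real x))) * f x))"
      by (metis norm_of_real)
    also have "\<dots> \<le> integral {0..1} (\<lambda>x. e * norm (f x))"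
    proof (rule integral_norm_bound_integral)
      fix x :: real assume "x \<in> {0..1}"
      hence "norm (cnj (f x) - g (ee (of_real x))) \<le> e"
        using g(2)[of "ee (of_real x)"] F[of x] by (simp add: norm_ee)
      thus "norm ((cnj (f x) - g (ee (of_real x))) * f x) \<le> e * norm (f x)"
        by (auto simp: norm_mult intro!: mult_right_mono)
    qed (auto intro!: integrable_continuous_interval continuous_intros cont cg)
    also have "\<dots> = e * J" by (simp add: J_def)
    finally show ?thesis .
  qed
  have "\<bar>I\<bar> \<le> 0"
  proof (rule field_le_epsilon)
    fix e :: real assume e: "e > 0"
    \<comment> \<open>Dividing by \<open>J + 1\<close> covers the case \<open>J = 0\<close>.\<close>
    have "\<bar>I\<bar> \<le> e / (J + 1) * J" using J e by (intro bound) auto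
    also have "\<dots> \<le> 0 + e" using J e by (simp add: field_simps)
    finally show "\<bar>I\<bar> \<le> 0 + e" .
  qed
  hence "I = 0" by simp
  hence "\<forall>x\<in>{0..1}. (norm (f x))\<^sup>2 = 0"
    unfolding I_def by (subst (asm) integral_eq_0_iff[OF cf2]) auto
  thus ?thesis using x by auto
qed

section \<open>Poisson summation for Gaussians\<close>

lemma gaussian_fourier_transform:
  fixes c s :: real
  assumes c: "c > 0"
  shows "integrable lborel (\<lambda>t. of_real (exp (- pi * c * t\<^sup>2)) * ee (of_real (s * t)))"
    and "(LBINT t. of_real (exp (- pi * c * t\<^sup>2)) * ee (of_real (s * t))) = of_real (exp (- pi * s\<^sup>2 / c) / sqrt c)"
proof -
  \<comment> \<open>The scale \<open>d\<close> turns the density exponent into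
    \<open>pi * c * t\<^sup>2\<close>, and \<open>r\<close> is fixed by
    \<open>r * d = 2 * pi * s\<close>; the claim becomes the characteristic function of the standard
    normal law at \<open>r\<close>.\<close>
  define r where "r = s * sqrt (2 * pi / c)"
  define d where "d = sqrt (2 * pi * c)"
  have d: "d > 0" using c by (simp add: d_def)
  define H where "H = (\<lambda>x. std_normal_density x *\<^sub>R iexp (r * x))"
  define G where "G = (\<lambda>t. of_real (exp (- pi * c * t\<^sup>2)) * ee (of_real (s * t)))"
  have rd: "r * d = 2 * pi * s"
  proof -
    have "r * d = s * sqrt ((2 * pi / c) * (2 * pi * c))" by (simp only: r_def d_def mult.assoc real_sqrt_mult[symmetric])
    also have "(2 * pi / c) * (2 * pi * c) = (2 * pi)\<^sup>2" using c by (simp add: power2_eq_square)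
    also have "sqrt ((2 * pi)\<^sup>2) = 2 * pi" by (subst real_sqrt_abs) simp
    finally show ?thesis by simp
  qed
  have d2: "d\<^sup>2 / 2 = pi * c" using c by (simp add: d_def)
  have HG: "H (0 + d * t) = of_real (1 / sqrt (2 * pi)) * G t" for t
  proof -
    have "std_normal_density (d * t) = 1 / sqrt (2 * pi) * exp (- pi * c * t\<^sup>2)"
      using d2 by (simp add: std_normal_density_def power_mult_distrib)
    moreover have "iexp (r * (d * t)) = ee (of_real (s * t))"
      unfolding ee_def by (intro arg_cong[of _ _ exp]) (use rd in \<open>simp add: complex_eq_iff mult_ac\<close>)
    ultimately show ?thesis by (simp add: H_def G_def scaleR_conv_of_real)
  qed
  have intH: "integrable lborel H"
  proof (rule Bochner_Integration.integrable_bound)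
    show "integrable lborel std_normal_density" by simp
    show "AE x in lborel. norm (H x) \<le> norm (std_normal_density x)"
      by (simp add: H_def)
  qed (simp add: H_def)
  have "integrable lborel (\<lambda>t. H (0 + d * t))"
    using intH d by (intro lborel_integrable_real_affine) auto
  hence "integrable lborel (\<lambda>t. of_real (sqrt (2 * pi)) * H (0 + d * t))" by simp
  also have "(\<lambda>t. of_real (sqrt (2 * pi)) * H (0 + d * t)) = G"
    unfolding HG by (auto simp: fun_eq_iff)
  finally show "integrable lborel (\<lambda>t. of_real (exp (- pi * c * t\<^sup>2)) * ee (of_real (s * t)))"
    by (simp add: G_def)
  have "char std_normal_distribution r = (LBINT x. H x)"
    unfolding char_def H_def by (subst integral_density) auto
  also have "\<dots> = d *\<^sub>R (LBINT t. H (0 + d * t))"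
    using d by (subst lborel_integral_real_affine[of d _ 0]) auto
  also have "\<dots> = of_real (d / sqrt (2 * pi)) * (LBINT t. G t)"
    unfolding HG by (simp add: scaleR_conv_of_real)
  also have "d / sqrt (2 * pi) = sqrt c" using c by (simp add: d_def real_sqrt_mult)
  also have "char std_normal_distribution r = of_real (exp (- pi * s\<^sup>2 / c))"
    using c by (simp add: char_std_normal_distribution r_def power_mult_distrib mult.commute)
  finally show "(LBINT t. of_real (exp (- pi * c * t\<^sup>2)) * ee (of_real (s * t))) = of_real (exp (- pi * s\<^sup>2 / c) / sqrt c)"
    using c by (simp add: G_def field_simps)
qed

text \<open>Both sides are limits of the integral of \<open>G\<close> over \<open>{-N..N}\<close>:
  the left one because the blocks \<open>{-N..<N}\<close> are cofinal among finite sets of integers,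
  the right one by dominated convergence.\<close>

lemma infsum_integral_translates:
  fixes G :: "real \<Rightarrow> complex"
  assumes cont: "continuous_on UNIV G" and int: "integrable lborel G"
  assumes sum: "(\<lambda>b::int. integral {0..1} (\<lambda>x. G (of_int b + x))) summable_on UNIV"
  shows "(\<Sum>\<^sub>\<infinity>b::int. integral {0..1} (\<lambda>x. G (of_int b + x))) = (LBINT x. G x)"
proof -
  define I where "I = (\<lambda>b::int. integral {0..1} (\<lambda>x. G (of_int b + x)))"
  have I: "I b = integral {of_int b..of_int b + 1} G" for b
    unfolding I_def using integral_shift_Icc_real[of 0 1 G "of_int b"] by (simp add: o_def add.commute)
  have intG: "G integrable_on {a..b}" for a b
    by (rule integrable_continuous_interval) (rule continuous_on_subset[OF cont], simp)
  have eq: "(\<Sum>b\<in>{-int N..<int N}. I b) = integral {-real N..real N} G" for N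
  proof (induction N)
    case (Suc N)
    have "{-int (Suc N)..<int (Suc N)} = insert (-int N - 1) (insert (int N) {-int N..<int N})" by auto
    hence "(\<Sum>b\<in>{-int (Suc N)..<int (Suc N)}. I b) = I (-int N - 1) + (integral {-real N..real N} G + I (int N))"
      using Suc by simp
    also have "I (int N) = integral {real N..real N + 1} G" by (simp add: I)
    also have "integral {-real N..real N} G + \<dots> = integral {-real N..real N + 1} G"
      by (intro Henstock_Kurzweil_Integration.integral_combine intG) auto
    also have "I (-int N - 1) = integral {-real N - 1..-real N} G" by (simp add: I)
    also have "\<dots> + integral {-real N..real N + 1} G = integral {-real N - 1..real N + 1} G"
      by (intro Henstock_Kurzweil_Integration.integral_combine intG) auto
    also have "- real N - 1 = - real (Suc N)" by simp
    also have "real N + 1 = real (Suc N)" by simp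
    finally show ?case .
  qed simp
  have "(sum I \<longlongrightarrow> infsum I UNIV) (finite_subsets_at_top UNIV)"
    using has_sum_infsum[OF sum] by (simp add: has_sum_def I_def)
  moreover have "filterlim (\<lambda>N. {-int N..<int N}) (finite_subsets_at_top UNIV) sequentially"
    unfolding filterlim_finite_subsets_at_top
  proof safe
    fix X :: "int set" assume "finite X"
    hence "eventually (\<lambda>N. \<forall>x\<in>X. nat (\<bar>x\<bar>) < N) sequentially"
      by (intro eventually_ball_finite ballI eventually_gt_at_top)
    thus "\<forall>\<^sub>F N in sequentially. finite {-int N..<int N} \<and> X \<subseteq> {-int N..<int N} \<and> {-int N..<int N} \<subseteq> UNIV"
      by eventually_elim fastforce
  qed
  ultimately have "(\<lambda>N. \<Sum>b\<in>{-int N..<int N}. I b) \<longlonglongrightarrow> infsum I UNIV"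
    by (rule filterlim_compose)
  hence lim1: "(\<lambda>N. integral {-real N..real N} G) \<longlonglongrightarrow> infsum I UNIV" by (simp only: eq)
  have "(\<lambda>N. LBINT x. indicator {-real N..real N} x *\<^sub>R G x) \<longlonglongrightarrow> (LBINT x. G x)"
  proof (rule integral_dominated_convergence)
    show "integrable lborel (\<lambda>x. norm (G x))" using int by simp
    show "AE x in lborel. (\<lambda>N. indicator {-real N..real N} x *\<^sub>R G x) \<longlonglongrightarrow> G x"
    proof (rule AE_I2)
      fix x :: real
      have "eventually (\<lambda>N. N > nat \<lceil>\<bar>x\<bar>\<rceil>) sequentially" by (rule eventually_gt_at_top)
      hence "eventually (\<lambda>N. indicator {-real N..real N} x *\<^sub>R G x = G x) sequentially"
      proof eventually_elim
        case (elim N)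
        hence "\<bar>x\<bar> \<le> real N" by linarith
        hence "x \<in> {-real N..real N}" by auto
        thus ?case by simp
      qed
      thus "(\<lambda>N. indicator {-real N..real N} x *\<^sub>R G x) \<longlonglongrightarrow> G x"
        by (rule tendsto_eventually)
    qed
    show "AE x in lborel. norm (indicator {-real N..real N} x *\<^sub>R G x) \<le> norm (G x)" for N
      by (auto simp: indicator_def)
  qed (use int in auto)
  also have "(\<lambda>N. LBINT x. indicator {-real N..real N} x *\<^sub>R G x) = (\<lambda>N. integral {-real N..real N} G)"
  proof
    fix N
    have "set_integrable lborel {-real N..real N} G"
      using int unfolding set_integrable_def by (intro integrable_mult_indicator) auto
    thus "(LBINT x. indicator {-real N..real N} x *\<^sub>R G x) = integral {-real N..real N} G"
      using set_borel_integral_eq_integral(2) by (force simp: set_lebesgue_integral_def)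
  qed
  finally show ?thesis using lim1 LIMSEQ_unique by (simp add: I_def)
qed

text \<open>Dropping \<open>x\<^sup>2\<close> from the expanded square trades a shift of the centre
  for a linear term that is uniform in \<open>x\<close>.\<close>

lemma gaussian_shift_le:
  fixes \<alpha> t x X :: real
  assumes "\<alpha> \<ge> 0" "\<bar>x\<bar> \<le> X"
  shows "exp (- \<alpha> * (t + x)\<^sup>2) \<le> exp (- \<alpha> * t\<^sup>2 + 2 * \<alpha> * X * \<bar>t\<bar>)"
proof -
  have "t\<^sup>2 + 2 * (t * x) \<le> (t + x)\<^sup>2" by (simp add: power2_eq_square algebra_simps)
  moreover have "- (t * x) \<le> X * \<bar>t\<bar>"
  proof -
    have "- (t * x) \<le> \<bar>x\<bar> * \<bar>t\<bar>" by (metis abs_ge_minus_self abs_mult mult.commute)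
    also have "\<dots> \<le> X * \<bar>t\<bar>" using assms by (intro mult_right_mono) auto
    finally show ?thesis .
  qed
  ultimately have "t\<^sup>2 - 2 * (X * \<bar>t\<bar>) \<le> (t + x)\<^sup>2" by linarith
  hence "\<alpha> * (t\<^sup>2 - 2 * (X * \<bar>t\<bar>)) \<le> \<alpha> * (t + x)\<^sup>2" using assms by (intro mult_left_mono) auto
  thus ?thesis by (simp add: algebra_simps)
qed

lemma infsum_int_shift: "(\<Sum>\<^sub>\<infinity>b::int. f (b + k)) = (\<Sum>\<^sub>\<infinity>b::int. f b)"
  by (rule infsum_reindex_bij_witness[of _ "\<lambda>b. b - k" "\<lambda>b. b + k"]) auto

text \<open>As functions of \<open>x\<close> both sides are continuous with period 1, so comparing
  Fourier coefficients suffices. On the left the integral over one period unfolds to the Fourier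
  transform at \<open>n + \<eta>\<close>; on the right orthogonality leaves only
  \<open>k = -n\<close>.\<close>

lemma poisson_gaussian_real:
  fixes c \<eta> x :: real
  assumes c: "c > 0"
  shows "(\<Sum>\<^sub>\<infinity>b::int. of_real (exp (- pi * c * (of_int b + x)\<^sup>2)) * ee (of_real (\<eta> * (of_int b + x)))) =
         of_real (1 / sqrt c) * (\<Sum>\<^sub>\<infinity>k::int. of_real (exp (- pi * (of_int k - \<eta>)\<^sup>2 / c)) * ee (of_real (of_int k * x)))"
    (is "?P x = of_real (1 / sqrt c) * ?Q x")
proof -
  define g where "g = (\<lambda>t::real. of_real (exp (- pi * c * t\<^sup>2)) * ee (of_real (\<eta> * t)))"
  define q where "q = (\<lambda>k::int. exp (- pi * (of_int k - \<eta>)\<^sup>2 / c))"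
  define P where "P = (\<lambda>x. \<Sum>\<^sub>\<infinity>b::int. g (of_int b + x))"
  define Q where "Q = (\<lambda>x. \<Sum>\<^sub>\<infinity>k::int. of_real (q k) * ee (of_real (of_int k * x)))"
  have cont_g: "continuous_on A g" for A
    unfolding g_def by (intro continuous_intros)
  define M where "M = (\<lambda>b::int. exp (- (pi * c) * (of_int b)\<^sup>2 + 2 * (pi * c) * 1 * \<bar>of_int b\<bar>))"
  have M: "M summable_on UNIV"
    unfolding M_def by (intro summable_on_int_gaussian) (use c in auto)
  have leM: "norm (g (of_int b + x)) \<le> M b" if "x \<in> {0..1}" for b x
    using gaussian_shift_le[of "pi * c" x 1 "of_int b"] that c
    by (simp add: g_def M_def norm_mult norm_ee)
  have q: "q summable_on UNIV"
  proof (rule summable_on_comparison_test)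
    show "(\<lambda>k::int. exp (- (pi / c) * (of_int k)\<^sup>2 + 2 * (pi / c) * \<bar>\<eta>\<bar> * \<bar>of_int k\<bar>)) summable_on UNIV"
      by (intro summable_on_int_gaussian) (use c in auto)
    show "q k \<le> exp (- (pi / c) * (of_int k)\<^sup>2 + 2 * (pi / c) * \<bar>\<eta>\<bar> * \<bar>of_int k\<bar>)" for k
      using gaussian_shift_le[of "pi / c" "-\<eta>" "\<bar>\<eta>\<bar>" "of_int k"] c by (simp add: q_def)
  qed (auto simp: q_def)
  have contP: "continuous_on {0..1} P"
    unfolding P_def
    by (rule has_sum_integral(1)[OF _ leM M]) (auto intro!: continuous_on_compose2[OF cont_g[of UNIV]] continuous_intros)
  have contQ: "continuous_on {0..1} Q"
    unfolding Q_def
    by (rule has_sum_integral(1)[OF _ _ q]) (auto intro!: continuous_intros simp: norm_mult norm_ee q_def)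
  have P_int: "P (x + of_int n) = P x" for x n
    unfolding P_def using infsum_int_shift[of "\<lambda>b. g (of_int b + x)" n] by (simp add: add_ac)
  have Q_int: "Q (x + of_int n) = Q x" for x n
    unfolding Q_def by (intro infsum_cong) (simp add: ring_distribs ee_add flip: of_int_mult)
  have coeffP: "integral {0..1} (\<lambda>x. P x * ee (of_int n * of_real x)) = of_real (exp (- pi * (of_int n + \<eta>)\<^sup>2 / c) / sqrt c)" for n
  proof -
    define G where "G = (\<lambda>t. of_real (exp (- pi * c * t\<^sup>2)) * ee (of_real ((of_int n + \<eta>) * t)))"
    have G: "g t * ee (of_int n * of_real t) = G t" for t
      by (simp add: g_def G_def ring_distribs ee_add)
    \<comment> \<open>Since \<open>ee (n b) = 1\<close>, the character at \<open>x\<close> may be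
      read at \<open>b + x\<close>; this is what makes the unfolding possible.\<close>
    have G2: "g (of_int b + x) * ee (of_int n * of_real x) = G (of_int b + x)" for b x
      unfolding G[symmetric] by (simp add: ring_distribs ee_add flip: of_int_mult)
    have intG: "integrable lborel G"
      unfolding G_def by (rule gaussian_fourier_transform(1)[OF c])
    have cont: "continuous_on UNIV G"
      unfolding G_def by (intro continuous_intros)
    have hs: "((\<lambda>b::int. integral {0..1} (\<lambda>x. G (of_int b + x))) has_sum integral {0..1} (\<lambda>x. \<Sum>\<^sub>\<infinity>b::int. G (of_int b + x))) UNIV"
    proof (rule has_sum_integral(2)[OF _ _ M])
      show "norm (G (of_int b + x)) \<le> M b" if "x \<in> {0..1}" for b x
        using leM[OF that, of b] by (simp add: norm_mult norm_ee flip: G2)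
    qed (auto intro!: continuous_on_compose2[OF cont] continuous_intros)
    have "(\<Sum>\<^sub>\<infinity>b::int. G (of_int b + x)) = P x * ee (of_int n * of_real x)" for x
      unfolding P_def G2[symmetric] by (rule infsum_cmult_left')
    hence "integral {0..1} (\<lambda>x. P x * ee (of_int n * of_real x)) = (\<Sum>\<^sub>\<infinity>b::int. integral {0..1} (\<lambda>x. G (of_int b + x)))"
      using hs by (simp add: infsumI)
    also have "\<dots> = (LBINT t. G t)"
      by (rule infsum_integral_translates) (use cont hs intG in \<open>auto simp: summable_on_def\<close>)
    also have "\<dots> = of_real (exp (- pi * (of_int n + \<eta>)\<^sup>2 / c) / sqrt c)"
      unfolding G_def by (rule gaussian_fourier_transform(2)[OF c])
    finally show ?thesis .
  qed
  have coeffQ: "integral {0..1} (\<lambda>x. Q x * ee (of_int n * of_real x)) = of_real (q (-n))" for n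
  proof -
    have int: "integral {0..1} (\<lambda>x. of_real (q k) * ee (of_int (k + n) * of_real x)) = (if k = -n then of_real (q k) else 0)" for k
    proof (cases "k = -n")
      case False
      define m where "m = k + n"
      have m: "m \<noteq> 0" using False by (simp add: m_def)
      have "((\<lambda>x. ee (of_int m * of_real x)) has_integral
               (ee (of_int m * of_real 1) / (2 * pi * \<i> * of_int m) - ee (of_int m * of_real 0) / (2 * pi * \<i> * of_int m))) {0..1::real}"
        unfolding ee_def using m
        by (intro fundamental_theorem_of_calculus)
           (auto simp: ee_def has_real_derivative_iff_has_vector_derivative[symmetric]
                 intro!: derivative_eq_intros has_vector_derivative_real_field)
      hence "integral {0..1} (\<lambda>x. ee (of_int m * of_real x)) = 0"
        by (simp add: integral_unique)
      thus ?thesis using False unfolding m_def[symmetric] by simp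
    qed simp
    have *: "Q x * ee (of_int n * of_real x) = (\<Sum>\<^sub>\<infinity>k::int. of_real (q k) * ee (of_int (k + n) * of_real x))" for x
      unfolding Q_def by (subst infsum_cmult_left'[symmetric]) (auto intro!: infsum_cong simp: ring_distribs ee_add)
    have "((\<lambda>k. integral {0..1} (\<lambda>x. of_real (q k) * ee (of_int (k + n) * of_real x))) has_sum
            integral {0..1} (\<lambda>x. \<Sum>\<^sub>\<infinity>k::int. of_real (q k) * ee (of_int (k + n) * of_real x))) UNIV"
      by (rule has_sum_integral(2)[OF _ _ q]) (auto intro!: continuous_intros simp: norm_mult norm_ee q_def)
    hence "((\<lambda>k. if k = -n then of_real (q k) else 0) has_sum integral {0..1} (\<lambda>x. Q x * ee (of_int n * of_real x))) UNIV"
      unfolding int * .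
    moreover have "((\<lambda>k. if k = -n then complex_of_real (q k) else 0) has_sum of_real (q (-n))) UNIV"
      by (rule has_sum_finite_neutralI[of "{-n}"]) auto
    ultimately show ?thesis by (rule has_sum_unique)
  qed
  define f where "f = (\<lambda>x. P x - of_real (1 / sqrt c) * Q x)"
  have contf: "continuous_on {0..1} f" unfolding f_def by (intro continuous_intros contP contQ)
  have "P 0 = P 1" "Q 0 = Q 1" using P_int[of 0 1] Q_int[of 0 1] by auto
  hence f01: "f 0 = f 1" by (simp add: f_def)
  have zero: "integral {0..1} (\<lambda>x. f x * ee (of_int n * of_real x)) = 0" for n
  proof -
    have "integral {0..1} (\<lambda>x. f x * ee (of_int n * of_real x)) =
        integral {0..1} (\<lambda>x. P x * ee (of_int n * of_real x) - of_real (1 / sqrt c) * (Q x * ee (of_int n * of_real x)))"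
      by (simp add: f_def algebra_simps)
    also have "\<dots> = integral {0..1} (\<lambda>x. P x * ee (of_int n * of_real x)) - of_real (1 / sqrt c) * integral {0..1} (\<lambda>x. Q x * ee (of_int n * of_real x))"
      by (subst integral_diff) (use c in \<open>auto intro!: integrable_continuous_interval continuous_intros contP contQ\<close>)
    also have "(- of_int n - \<eta>)\<^sup>2 = (of_int n + \<eta>)\<^sup>2" by (simp add: power2_eq_square algebra_simps)
    hence "q (-n) = exp (- pi * (of_int n + \<eta>)\<^sup>2 / c)" by (simp add: q_def)
    hence "integral {0..1} (\<lambda>x. P x * ee (of_int n * of_real x)) - of_real (1 / sqrt c) * integral {0..1} (\<lambda>x. Q x * ee (of_int n * of_real x)) = 0"
      unfolding coeffP coeffQ by simp
    finally show ?thesis .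
  qed
  have "f (x + of_int (- \<lfloor>x\<rfloor>)) = 0"
    by (rule fourier_coeffs_zero_imp_zero[OF contf f01 zero]) (simp, linarith)
  hence "f x = 0" by (simp only: f_def P_int Q_int)
  thus ?thesis by (simp add: f_def P_def Q_def g_def q_def)
qed

text \<open>The imaginary part \<open>y\<close> of \<open>\<zeta>\<close> only replaces
  \<open>\<eta>\<close> by \<open>\<eta> - c * y\<close> and splits off the same constant
  \<open>K\<close> on both sides, so the real case applies without moving a contour.\<close>

lemma poisson_gaussian:
  fixes c \<eta> :: real and \<zeta> :: complex
  assumes c: "c > 0"
  shows "(\<Sum>\<^sub>\<infinity>b::int. exp (- of_real (pi * c) * (of_int b + \<zeta>)\<^sup>2) * ee (of_real \<eta> * (of_int b + \<zeta>))) =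
         of_real (1 / sqrt c) * (\<Sum>\<^sub>\<infinity>k::int. of_real (exp (- pi * (of_int k - \<eta>)\<^sup>2 / c)) * ee (of_int k * \<zeta>))"
proof -
  define x y where "x = Re \<zeta>" and "y = Im \<zeta>"
  have \<zeta>: "\<zeta> = of_real x + \<i> * of_real y" by (simp add: x_def y_def complex_eq_iff)
  define K where "K = complex_of_real (exp (pi * c * y\<^sup>2 - 2 * pi * \<eta> * y))"
  have 1: "exp (- of_real (pi * c) * (of_int b + \<zeta>)\<^sup>2) * ee (of_real \<eta> * (of_int b + \<zeta>)) =
        K * (of_real (exp (- pi * c * (of_int b + x)\<^sup>2)) * ee (of_real ((\<eta> - c * y) * (of_int b + x))))" for b :: int
    unfolding K_def ee_def exp_of_real[symmetric] mult_exp_exp \<zeta>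
    by (rule arg_cong[of _ _ exp]) (simp add: complex_eq_iff power2_eq_square algebra_simps)
  have 2: "of_real (exp (- pi * (of_int k - \<eta>)\<^sup>2 / c)) * ee (of_int k * \<zeta>) =
        K * (of_real (exp (- pi * (of_int k - (\<eta> - c * y))\<^sup>2 / c)) * ee (of_real (of_int k * x)))" for k :: int
    unfolding K_def ee_def exp_of_real[symmetric] mult_exp_exp \<zeta> using c
    by (intro arg_cong[of _ _ exp]) (simp add: complex_eq_iff power2_eq_square field_simps)
  show ?thesis
    unfolding 1 2 infsum_cmult_right' poisson_gaussian_real[OF c] by (simp only: mult_ac)
qed

section \<open>Gaussian sums with a simple pole\<close>

lemma infsum_diff:
  fixes f g :: "'a \<Rightarrow> 'b :: {topological_ab_group_add, t2_space}"
  assumes "f summable_on A" "g summable_on A"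
  shows "(\<Sum>\<^sub>\<infinity>x\<in>A. f x - g x) = infsum f A - infsum g A"
  using infsum_add[OF assms(1), of "\<lambda>x. - g x"] assms(2) by (simp add: infsum_uminus summable_on_uminus)

lemma dist_Ints_bounded_below:
  fixes \<zeta> :: complex
  assumes "\<zeta> \<notin> \<int>"
  shows "\<exists>e>0. \<forall>b::int. e \<le> norm (of_int b + \<zeta>)"
proof -
  have "open (- \<int> :: complex set)" by (simp add: closed_Ints open_Compl)
  then obtain e where e: "e > 0" "ball \<zeta> e \<subseteq> - \<int>"
    using assms open_contains_ball[of "- \<int> :: complex set"] by auto
  have "e \<le> norm (of_int b + \<zeta>)" for b :: int
  proof -
    have "of_int (- b) \<notin> ball \<zeta> e" using e(2) Ints_of_int[of "-b"] by blast
    thus ?thesis by (simp add: dist_norm add.commute)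
  qed
  with e show ?thesis by blast
qed

text \<open>
  Both sides \<open>L\<close> and \<open>G\<close> of the identity, as functions of \<open>\<eta>\<close>, satisfy a first-order difference equation
  with the same multiplier \<open>ee \<zeta>\<close>; the \<open>\<eta>\<close>-derivatives of \<open>L\<close> and \<open>\<pi> \<i> G\<close> agree by Poisson summation.
  Comparing the increments over \<open>[\<eta>, \<eta> + 1]\<close> gives a linear equation for \<open>L - \<pi> \<i> G\<close>.
\<close>

lemma gaussian_partial_fractions:
  fixes c \<eta> :: real and \<zeta> :: complex
  assumes c: "c > 0" and \<zeta>: "\<zeta> \<notin> \<int>"
  shows "(\<Sum>\<^sub>\<infinity>b::int. exp (- of_real (pi * c) * (of_int b + \<zeta>)\<^sup>2) * ee (of_real \<eta> * (of_int b + \<zeta>)) / (of_int b + \<zeta>)) =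
         of_real pi * \<i> * (\<Sum>\<^sub>\<infinity>k::int. of_real ((if k \<ge> 0 then 1 else -1) - EE ((of_int k - \<eta>) / sqrt c)) * ee (of_int k * \<zeta>))
           - 2 * of_real pi * \<i> / (1 - ee \<zeta>)"
proof -
  define x y where "x = Re \<zeta>" and "y = Im \<zeta>"
  define h where "h = (\<lambda>b::int. \<lambda>t::real. exp (- of_real (pi * c) * (of_int b + \<zeta>)\<^sup>2) * ee (of_real t * (of_int b + \<zeta>)))"
  define p where "p = (\<lambda>k::int. \<lambda>t::real. of_real (exp (- pi * (of_int k - t)\<^sup>2 / c)) * ee (of_int k * \<zeta>))"
  define E where "E = (\<lambda>k::int. \<lambda>t::real. of_real ((if k \<ge> 0 then 1 else -1) - EE ((of_int k - t) / sqrt c)) * ee (of_int k * \<zeta>))"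
  define L where "L = (\<lambda>t. \<Sum>\<^sub>\<infinity>b::int. h b t / (of_int b + \<zeta>))"
  define G where "G = (\<lambda>t. \<Sum>\<^sub>\<infinity>k::int. E k t)"
  obtain e where e: "e > 0" "\<And>b::int. e \<le> norm (of_int b + \<zeta>)"
    using dist_Ints_bounded_below[OF \<zeta>] by blast
  have nz: "of_int b + \<zeta> \<noteq> 0" for b :: int
    using e(1) e(2)[of b] by auto

  \<comment> \<open>A bound for \<open>\<bar>t\<bar>\<close> on all of
    \<open>{\<eta>..\<eta>+1}\<close>, so that the majorants do not depend on
    \<open>t\<close>.\<close>
  define N where "N = \<bar>\<eta>\<bar> + 1"
  define C where "C = exp (pi * c * y\<^sup>2 + 2 * pi * N * \<bar>y\<bar>)"
  have h_le: "norm (h b t) \<le> C * exp (- (pi * c) * (of_int b)\<^sup>2 + 2 * (pi * c) * \<bar>x\<bar> * \<bar>of_int b\<bar>)"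
    if "\<bar>t\<bar> \<le> N" for b t
  proof -
    have "- (t * y) \<le> N * \<bar>y\<bar>"
      using that by (metis abs_ge_minus_self abs_mult abs_ge_zero mult_right_mono order_trans)
    hence "pi * (- (t * y)) \<le> pi * (N * \<bar>y\<bar>)" by (intro mult_left_mono) auto
    have "norm (h b t) = exp (pi * c * y\<^sup>2 - 2 * pi * (t * y)) * exp (- (pi * c) * (of_int b + x)\<^sup>2)"
      unfolding h_def norm_mult norm_exp_eq_Re norm_ee mult_exp_exp
      by (simp add: x_def y_def power2_eq_square algebra_simps)
    also have "\<dots> \<le> C * exp (- (pi * c) * (of_int b)\<^sup>2 + 2 * (pi * c) * \<bar>x\<bar> * \<bar>of_int b\<bar>)"
      unfolding C_def using \<open>pi * (- (t * y)) \<le> _\<close> c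
      by (intro mult_mono gaussian_shift_le) (auto simp: algebra_simps)
    finally show ?thesis .
  qed
  have q_le: "exp (- pi * (of_int k - t)\<^sup>2 / c) * norm (ee (of_int k * \<zeta>)) \<le>
        exp (- (pi / c) * (of_int k)\<^sup>2 + (2 * (pi / c) * N + 2 * pi * \<bar>y\<bar>) * \<bar>of_int k\<bar>)"
    if "\<bar>t\<bar> \<le> N" for k :: int and t
  proof -
    have "norm (ee (of_int k * \<zeta>)) \<le> exp (2 * pi * \<bar>y\<bar> * \<bar>of_int k\<bar>)"
      using mult_left_mono[OF abs_ge_minus_self[of "of_int k * y"], of "2 * pi"]
      by (simp add: norm_ee y_def abs_mult mult_ac)
    moreover have "exp (- pi * (of_int k - t)\<^sup>2 / c) \<le> exp (- (pi / c) * (of_int k)\<^sup>2 + 2 * (pi / c) * N * \<bar>of_int k\<bar>)"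
      using gaussian_shift_le[of "pi / c" "-t" N "of_int k"] c that by simp
    ultimately have "exp (- pi * (of_int k - t)\<^sup>2 / c) * norm (ee (of_int k * \<zeta>)) \<le>
       exp (- (pi / c) * (of_int k)\<^sup>2 + 2 * (pi / c) * N * \<bar>of_int k\<bar>) * exp (2 * pi * \<bar>y\<bar> * \<bar>of_int k\<bar>)"
      by (intro mult_mono) auto
    thus ?thesis by (simp add: mult_exp_exp algebra_simps)
  qed

  have L_sum: "(\<lambda>b. h b t / (of_int b + \<zeta>)) summable_on UNIV" if "\<bar>t\<bar> \<le> N" for t
  proof (rule summable_on_int_gaussian_bound)
    fix b :: int
    have "norm (h b t / (of_int b + \<zeta>)) \<le> (C * exp (- (pi * c) * (of_int b)\<^sup>2 + 2 * (pi * c) * \<bar>x\<bar> * \<bar>of_int b\<bar>)) / e"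
      unfolding norm_divide using e h_le[OF that, of b] by (intro frac_le) (auto simp: C_def)
    thus "norm (h b t / (of_int b + \<zeta>)) \<le> C / e * exp (- (pi * c) * (of_int b)\<^sup>2 + (2 * (pi * c) * \<bar>x\<bar>) * \<bar>of_int b\<bar>)"
      by simp
  qed (use c in auto)
  have G_sum: "(\<lambda>k. E k t) summable_on UNIV" if "\<bar>t\<bar> \<le> N" for t
  proof (rule summable_on_int_gaussian_bound)
    fix k :: int
    have "norm (E k t) \<le> (2 * exp (pi * t\<^sup>2 / c) * exp (- pi * (of_int k - t)\<^sup>2 / c)) * norm (ee (of_int k * \<zeta>))"
      unfolding E_def norm_mult norm_of_real
      by (intro mult_right_mono abs_sign_minus_EE_le c) auto
    also have "\<dots> = 2 * exp (pi * t\<^sup>2 / c) * (exp (- pi * (of_int k - t)\<^sup>2 / c) * norm (ee (of_int k * \<zeta>)))"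
      by simp
    also have "\<dots> \<le> 2 * exp (pi * t\<^sup>2 / c) * exp (- (pi / c) * (of_int k)\<^sup>2 + (2 * (pi / c) * N + 2 * pi * \<bar>y\<bar>) * \<bar>of_int k\<bar>)"
      by (intro mult_left_mono q_le that) auto
    finally show "norm (E k t) \<le> \<dots>" .
  qed (use c in auto)

  have L_shift: "L (t + 1) = ee \<zeta> * L t" for t
    unfolding L_def infsum_cmult_right'[symmetric]
    by (intro infsum_cong) (simp add: h_def ring_distribs ee_add)
  have G_shift: "G (t + 1) = ee \<zeta> * G t + 2" if t: "\<bar>t\<bar> \<le> N" for t
  proof -
    have "G (t + 1) = (\<Sum>\<^sub>\<infinity>k::int. E (k + 1) (t + 1))"
      unfolding G_def by (rule infsum_int_shift[symmetric])
    \<comment> \<open>The argument of \<open>EE\<close> depends on \<open>k - t\<close> only,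
      whereas the sign at \<open>k + 1\<close> differs from the sign at \<open>k\<close> exactly for
      \<open>k = -1\<close>. There the jump 2 meets \<open>ee 0 = 1\<close>. This inhomogeneity
      produces the pole term.\<close>
    also have "\<dots> = (\<Sum>\<^sub>\<infinity>k::int. ee \<zeta> * E k t + (if k = -1 then 2 else 0))"
    proof (rule infsum_cong)
      fix k :: int
      have "ee \<zeta> * ee (- \<zeta>) = 1" "ee (- \<zeta>) * ee \<zeta> = 1" by (simp_all add: ee_minus)
      thus "E (k + 1) (t + 1) = ee \<zeta> * E k t + (if k = -1 then 2 else 0)"
        by (auto simp: E_def ring_distribs ee_add)
    qed
    also have "\<dots> = ee \<zeta> * G t + (\<Sum>\<^sub>\<infinity>k::int. if k = -1 then 2 else 0)"
      unfolding G_def infsum_cmult_right'[symmetric]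
    proof (rule infsum_add)
      show "(\<lambda>k. ee \<zeta> * E k t) summable_on UNIV" by (intro summable_on_cmult_right G_sum t)
      have "((\<lambda>k::int. if k = -1 then 2 else 0 :: complex) has_sum 2) UNIV"
        by (rule has_sum_finite_neutralI[of "{-1}"]) auto
      thus "(\<lambda>k::int. if k = -1 then 2 else 0 :: complex) summable_on UNIV" by (auto simp: summable_on_def)
    qed
    also have "(\<Sum>\<^sub>\<infinity>k::int. if k = -1 then 2 else 0 :: complex) = 2"
      by (rule infsumI, rule has_sum_finite_neutralI[of "{-1}"]) auto
    finally show ?thesis .
  qed

  \<comment> \<open>Dividing by \<open>of_int b + \<zeta>\<close> is integrating \<open>h b\<close>
    in \<open>t\<close>, up to \<open>2 * pi * \<i>\<close>; in this way the sum with denominators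
    is tied to the Gaussian sum without them.\<close>
  have hint: "integral {\<eta>..\<eta>+1} (h b) = 1 / (2 * of_real pi * \<i>) * (h b (\<eta> + 1) / (of_int b + \<zeta>) - h b \<eta> / (of_int b + \<zeta>))" for b
  proof -
    have "(h b has_integral (h b (\<eta> + 1) / (2 * of_real pi * \<i> * (of_int b + \<zeta>)) - h b \<eta> / (2 * of_real pi * \<i> * (of_int b + \<zeta>)))) {\<eta>..\<eta>+1}"
      unfolding h_def ee_def using nz[of b]
      by (intro fundamental_theorem_of_calculus)
         (auto intro!: derivative_eq_intros has_vector_derivative_real_field)
    from integral_unique[OF this] show ?thesis by (simp add: right_diff_distrib)
  qed
  \<comment> \<open>The sign in \<open>E\<close> does not depend on \<open>t\<close> and cancels in
    the increment; only the primitive \<open>EE\<close> contributes.\<close>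
  have pint: "integral {\<eta>..\<eta>+1} (p k) = of_real (sqrt c / 2) * (E k (\<eta> + 1) - E k \<eta>)" for k
  proof -
    have "((\<lambda>t. exp (- pi * (of_int k - t)\<^sup>2 / c)) has_integral
        (- sqrt c / 2 * EE ((of_int k - (\<eta> + 1)) / sqrt c) - (- sqrt c / 2 * EE ((of_int k - \<eta>) / sqrt c)))) {\<eta>..\<eta>+1}"
    proof (rule fundamental_theorem_of_calculus)
      fix t :: real
      have "((\<lambda>t. - sqrt c / 2 * EE ((of_int k - t) / sqrt c)) has_real_derivative
             - sqrt c / 2 * (2 * exp (- pi * ((of_int k - t) / sqrt c)\<^sup>2) * (- 1 / sqrt c))) (at t within {\<eta>..\<eta>+1})"
        using c by (auto intro!: derivative_eq_intros DERIV_chain2[OF EE_has_real_derivative])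
      also have "- sqrt c / 2 * (2 * exp (- pi * ((of_int k - t) / sqrt c)\<^sup>2) * (- 1 / sqrt c)) = exp (- pi * (of_int k - t)\<^sup>2 / c)"
        using c by (simp add: power_divide)
      finally show "((\<lambda>t. - sqrt c / 2 * EE ((of_int k - t) / sqrt c)) has_vector_derivative exp (- pi * (of_int k - t)\<^sup>2 / c)) (at t within {\<eta>..\<eta>+1})"
        by (simp add: has_real_derivative_iff_has_vector_derivative)
    qed simp
    hence "(p k has_integral of_real (- sqrt c / 2 * EE ((of_int k - (\<eta> + 1)) / sqrt c) - (- sqrt c / 2 * EE ((of_int k - \<eta>) / sqrt c))) * ee (of_int k * \<zeta>)) {\<eta>..\<eta>+1}"
      unfolding p_def by (intro has_integral_mult_left has_integral_of_real)
    hence "integral {\<eta>..\<eta>+1} (p k) = of_real (- sqrt c / 2 * EE ((of_int k - (\<eta> + 1)) / sqrt c) - (- sqrt c / 2 * EE ((of_int k - \<eta>) / sqrt c))) * ee (of_int k * \<zeta>)"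
      by (rule integral_unique)
    thus ?thesis by (simp add: E_def algebra_simps)
  qed

  have \<eta>N: "\<bar>\<eta>\<bar> \<le> N" "\<bar>\<eta> + 1\<bar> \<le> N" by (auto simp: N_def)
  have "((\<lambda>b. integral {\<eta>..\<eta>+1} (h b)) has_sum integral {\<eta>..\<eta>+1} (\<lambda>t. \<Sum>\<^sub>\<infinity>b. h b t)) UNIV"
  proof (rule has_sum_integral(2))
    show "(\<lambda>b::int. C * exp (- (pi * c) * (of_int b)\<^sup>2 + 2 * (pi * c) * \<bar>x\<bar> * \<bar>of_int b\<bar>)) summable_on UNIV"
      by (intro summable_on_cmult_right summable_on_int_gaussian) (use c in auto)
  next
    fix b t assume "t \<in> {\<eta>..\<eta>+1}"
    thus "norm (h b t) \<le> C * exp (- (pi * c) * (of_int b)\<^sup>2 + 2 * (pi * c) * \<bar>x\<bar> * \<bar>of_int b\<bar>)"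
      by (intro h_le) (auto simp: N_def)
  qed (auto simp: h_def intro!: continuous_intros)
  hence "integral {\<eta>..\<eta>+1} (\<lambda>t. \<Sum>\<^sub>\<infinity>b. h b t) =
          (\<Sum>\<^sub>\<infinity>b. 1 / (2 * of_real pi * \<i>) * (h b (\<eta> + 1) / (of_int b + \<zeta>) - h b \<eta> / (of_int b + \<zeta>)))"
    unfolding hint by (simp only: infsumI)
  also have "\<dots> = 1 / (2 * of_real pi * \<i>) * (L (\<eta> + 1) - L \<eta>)"
    unfolding L_def infsum_cmult_right' by (subst infsum_diff) (auto intro!: L_sum \<eta>N)
  finally have 1: "integral {\<eta>..\<eta>+1} (\<lambda>t. \<Sum>\<^sub>\<infinity>b. h b t) = 1 / (2 * of_real pi * \<i>) * (L (\<eta> + 1) - L \<eta>)" .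

  have "((\<lambda>k. integral {\<eta>..\<eta>+1} (p k)) has_sum integral {\<eta>..\<eta>+1} (\<lambda>t. \<Sum>\<^sub>\<infinity>k. p k t)) UNIV"
  proof (rule has_sum_integral(2))
    show "(\<lambda>k::int. exp (- (pi / c) * (of_int k)\<^sup>2 + (2 * (pi / c) * N + 2 * pi * \<bar>y\<bar>) * \<bar>of_int k\<bar>)) summable_on UNIV"
      by (intro summable_on_int_gaussian) (use c in auto)
  next
    fix k t assume "t \<in> {\<eta>..\<eta>+1}"
    hence "\<bar>t\<bar> \<le> N" by (auto simp: N_def)
    thus "norm (p k t) \<le> exp (- (pi / c) * (of_int k)\<^sup>2 + (2 * (pi / c) * N + 2 * pi * \<bar>y\<bar>) * \<bar>of_int k\<bar>)"
      using q_le[of t k] by (simp add: p_def norm_mult)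
  qed (use c in \<open>auto simp: p_def intro!: continuous_intros\<close>)
  hence "integral {\<eta>..\<eta>+1} (\<lambda>t. \<Sum>\<^sub>\<infinity>k. p k t) = (\<Sum>\<^sub>\<infinity>k. of_real (sqrt c / 2) * (E k (\<eta> + 1) - E k \<eta>))"
    unfolding pint by (simp add: infsumI)
  also have "\<dots> = of_real (sqrt c / 2) * (G (\<eta> + 1) - G \<eta>)"
    unfolding G_def infsum_cmult_right' by (subst infsum_diff) (auto intro!: G_sum \<eta>N)
  finally have 2: "integral {\<eta>..\<eta>+1} (\<lambda>t. \<Sum>\<^sub>\<infinity>k. p k t) = of_real (sqrt c / 2) * (G (\<eta> + 1) - G \<eta>)" .

  have "(\<lambda>t. \<Sum>\<^sub>\<infinity>b. h b t) = (\<lambda>t. of_real (1 / sqrt c) * (\<Sum>\<^sub>\<infinity>k. p k t))"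
    unfolding h_def p_def by (intro ext poisson_gaussian c)
  hence "1 / (2 * of_real pi * \<i>) * (L (\<eta> + 1) - L \<eta>) = of_real (1 / sqrt c) * (of_real (sqrt c / 2) * (G (\<eta> + 1) - G \<eta>))"
    unfolding 1[symmetric] 2[symmetric] by simp
  also have "\<dots> = 1 / 2 * (G (\<eta> + 1) - G \<eta>)"
    using c by (simp flip: of_real_mult mult.assoc)
  finally have *: "1 / (2 * of_real pi * \<i>) * (L (\<eta> + 1) - L \<eta>) = 1 / 2 * (G (\<eta> + 1) - G \<eta>)" .
  have "L (\<eta> + 1) - L \<eta> = 2 * of_real pi * \<i> * (1 / (2 * of_real pi * \<i>) * (L (\<eta> + 1) - L \<eta>))"
    by simp
  also have "\<dots> = of_real pi * \<i> * (G (\<eta> + 1) - G \<eta>)"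
    unfolding * by simp
  finally have "L (\<eta> + 1) - L \<eta> = of_real pi * \<i> * (G (\<eta> + 1) - G \<eta>)" .
  hence "(ee \<zeta> - 1) * L \<eta> = of_real pi * \<i> * ((ee \<zeta> - 1) * G \<eta> + 2)"
    by (simp only: L_shift G_shift[OF \<eta>N(1)]) (simp add: algebra_simps)
  moreover have "ee \<zeta> - 1 \<noteq> 0" using \<zeta> by (simp add: ee_eq_1_iff)
  ultimately have "L \<eta> = of_real pi * \<i> * G \<eta> + 2 * of_real pi * \<i> / (ee \<zeta> - 1)"
    by (simp add: field_simps)
  also have "2 * of_real pi * \<i> / (ee \<zeta> - 1) = - (2 * of_real pi * \<i> / (1 - ee \<zeta>))"
    by (metis minus_diff_eq minus_divide_right)
  finally show ?thesis by (simp add: L_def G_def h_def E_def)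
qed

section \<open>The modified function as a lattice sum\<close>

lemma qp_eq_ee: "qp \<tau> x = ee (\<tau> * x)"
  by (simp add: qp_def ee_def mult_ac)

text \<open>A Gaussian-regularized summand of Kronecker-Eisenstein type. For
  \<open>l = a \<tau> + b\<close> the bracket equals \<open>(z1 + l)\<^sup>2 - 2 \<i> a (Im \<tau>)
  (l + z1 + z2) - 2 \<i> Im (z1 - z2) (z1 + l)\<close>: a holomorphic square for Poisson summation
  in \<open>b\<close>, plus terms linear in \<open>b\<close>. The form with \<open>cnj l\<close>
  refers to no basis of the lattice, as the changes of variables require.\<close>

definition lattice_kernel :: "real \<Rightarrow> complex \<Rightarrow> complex \<Rightarrow> complex \<Rightarrow> complex" where
  "lattice_kernel c z1 z2 l =
     exp (- of_real (pi * c) * (l * cnj l + (z1 + z2) * cnj l + cnj (z1 - z2) * (z1 + l) + z1 * z2)) / (z1 + l)"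

text \<open>With \<open>c * Im \<tau> = m\<close> the kernel contains the cross phase
  \<open>ee (m a b)\<close>; the factor \<open>ee (- m a b)\<close> cancels it, so that each row is
  a Gaussian sum against a character. For half-integral \<open>s\<close>, \<open>s\<close> enters
  only modulo 1.\<close>

definition lattice_term :: "complex \<Rightarrow> real \<Rightarrow> real \<Rightarrow> complex \<Rightarrow> complex \<Rightarrow> complex \<Rightarrow> int \<Rightarrow> int \<Rightarrow> complex" where
  "lattice_term \<epsilon> m s \<tau> z1 z2 a b =
     \<epsilon> powi a * ee (- of_real s * of_int b) * ee (- of_real m * of_int a * of_int b)
       * lattice_kernel (m / Im \<tau>) z1 z2 (of_int a * \<tau> + of_int b)"

section \<open>Absolute convergence of the lattice sum\<close>

lemma lattice_norm_ge:
  assumes "Im \<tau> > 0"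
  shows "\<exists>\<kappa>>0. \<forall>a b :: int. \<kappa> * ((of_int a)\<^sup>2 + (of_int b)\<^sup>2) \<le> (norm (of_int a * \<tau> + of_int b))\<^sup>2"
proof -
  define u v where "u = Re \<tau>" and "v = Im \<tau>"
  have v: "v > 0" using assms by (simp add: v_def)
  \<comment> \<open>With \<open>A = a\<close> and \<open>B = b\<close>, the two summands of
    \<open>K\<close> are the coefficients of \<open>(B + A u)\<^sup>2\<close> and
    \<open>(A v)\<^sup>2\<close> that arise when \<open>B\<^sup>2\<close> is bounded by
    \<open>2 (B + A u)\<^sup>2 + 2 (A u)\<^sup>2\<close>.\<close>
  define K where "K = 2 + (1 + 2 * u\<^sup>2) / v\<^sup>2"
  have K: "K > 0" using v by (simp add: K_def add_pos_nonneg)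
  have "1 / K * ((of_int a)\<^sup>2 + (of_int b)\<^sup>2) \<le> (norm (of_int a * \<tau> + of_int b))\<^sup>2" for a b :: int
  proof -
    define A B :: real where "A = of_int a" and "B = of_int b"
    have "2 * (B + A * u)\<^sup>2 + 2 * (A * u)\<^sup>2 - B\<^sup>2 = (B + 2 * A * u)\<^sup>2"
      by (simp add: power2_eq_square algebra_simps)
    hence "B\<^sup>2 \<le> 2 * (B + A * u)\<^sup>2 + 2 * (A * u)\<^sup>2"
      by (metis diff_ge_0_iff_ge zero_le_power2)
    hence "A\<^sup>2 + B\<^sup>2 \<le> 2 * (B + A * u)\<^sup>2 + (1 + 2 * u\<^sup>2) * A\<^sup>2"
      by (simp add: power_mult_distrib algebra_simps)
    also have "(1 + 2 * u\<^sup>2) * A\<^sup>2 = (1 + 2 * u\<^sup>2) / v\<^sup>2 * (A * v)\<^sup>2"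
      using v by (simp add: power_mult_distrib)
    also have "2 * (B + A * u)\<^sup>2 + (1 + 2 * u\<^sup>2) / v\<^sup>2 * (A * v)\<^sup>2 \<le> K * (B + A * u)\<^sup>2 + K * (A * v)\<^sup>2"
      using v by (intro add_mono mult_right_mono) (auto simp: K_def)
    also have "\<dots> = K * (norm (of_int a * \<tau> + of_int b))\<^sup>2"
      by (simp add: cmod_power2 A_def B_def u_def v_def algebra_simps)
    finally show ?thesis using K by (simp add: A_def B_def field_simps)
  qed
  with K show ?thesis by (intro exI[of _ "1 / K"]) auto
qed

text \<open>All but finitely many rows are at vertical distance at least \<open>Im \<tau>\<close>;
  each remaining row is a translate of the integers, which form a closed set.\<close>

lemma dist_lattice_bounded_below:
  fixes z \<tau> :: complex
  assumes \<tau>: "Im \<tau> > 0" and np: "\<And>a b :: int. z + (of_int a * \<tau> + of_int b) \<noteq> 0"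
  shows "\<exists>e>0. \<forall>a b :: int. e \<le> norm (z + (of_int a * \<tau> + of_int b))"
proof -
  define A where "A = {a::int. \<bar>Im z + of_int a * Im \<tau>\<bar> < Im \<tau>}"
  have "A \<subseteq> {- \<lceil>\<bar>Im z\<bar> / Im \<tau>\<rceil> - 1..\<lceil>\<bar>Im z\<bar> / Im \<tau>\<rceil> + 1}"
  proof
    fix a assume "a \<in> A"
    hence "\<bar>of_int a * Im \<tau>\<bar> < \<bar>Im z\<bar> + Im \<tau>" by (auto simp: A_def abs_if split: if_splits)
    hence "\<bar>of_int a\<bar> < \<bar>Im z\<bar> / Im \<tau> + 1" using \<tau> by (simp add: abs_mult field_simps)
    also have "\<dots> \<le> of_int (\<lceil>\<bar>Im z\<bar> / Im \<tau>\<rceil> + 1)" by simp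
    finally have "\<bar>a\<bar> < \<lceil>\<bar>Im z\<bar> / Im \<tau>\<rceil> + 1"
      by (simp only: of_int_less_iff flip: of_int_abs)
    thus "a \<in> {- \<lceil>\<bar>Im z\<bar> / Im \<tau>\<rceil> - 1..\<lceil>\<bar>Im z\<bar> / Im \<tau>\<rceil> + 1}" by auto
  qed
  hence "finite A" by (rule finite_subset) auto
  have "\<exists>e>0. \<forall>a\<in>A. \<forall>b::int. e \<le> norm (z + (of_int a * \<tau> + of_int b))"
    using \<open>finite A\<close>
  proof induction
    case (insert a A)
    have "z + of_int a * \<tau> \<notin> \<int>"
    proof
      assume "z + of_int a * \<tau> \<in> \<int>"
      then obtain n where "z + of_int a * \<tau> = of_int n" by (auto elim: Ints_cases)
      thus False using np[of a "-n"] by (simp add: algebra_simps)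
    qed
    from dist_Ints_bounded_below[OF this] obtain e1 where e1: "e1 > 0" "\<And>b::int. e1 \<le> norm (z + (of_int a * \<tau> + of_int b))"
      by (auto simp: add_ac)
    from insert.IH obtain e2 where e2: "e2 > 0" "\<And>a b::int. a \<in> A \<Longrightarrow> e2 \<le> norm (z + (of_int a * \<tau> + of_int b))"
      by blast
    show ?case
      by (rule exI[of _ "min e1 e2"]) (use e1 e2 in \<open>auto intro: min.coboundedI1 min.coboundedI2\<close>)
  qed (auto intro: exI[of _ 1])
  then obtain e where e: "e > 0" "\<And>a b::int. a \<in> A \<Longrightarrow> e \<le> norm (z + (of_int a * \<tau> + of_int b))" by blast
  have "min e (Im \<tau>) \<le> norm (z + (of_int a * \<tau> + of_int b))" for a b :: int
  proof (cases "a \<in> A")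
    case False
    hence "Im \<tau> \<le> \<bar>Im (z + (of_int a * \<tau> + of_int b))\<bar>" by (simp add: A_def)
    also have "\<dots> \<le> norm (z + (of_int a * \<tau> + of_int b))" by (rule abs_Im_le_cmod)
    finally show ?thesis by simp
  qed (use e in \<open>auto intro: min.coboundedI1\<close>)
  thus ?thesis using e \<tau> by (intro exI[of _ "min e (Im \<tau>)"]) auto
qed

text \<open>Only \<open>l * cnj l\<close> is quadratic in the exponent; the rest grows linearly in
  \<open>norm l\<close>, and the denominator stays away from 0.\<close>

lemma summable_lattice_term:
  assumes m: "m > 0" and \<tau>: "Im \<tau> > 0" and \<epsilon>: "norm \<epsilon> = 1"
  assumes np: "\<And>a b :: int. z1 + (of_int a * \<tau> + of_int b) \<noteq> 0"
  shows "(\<lambda>(a, b). lattice_term \<epsilon> m s \<tau> z1 z2 a b) summable_on UNIV"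
proof -
  define c where "c = m / Im \<tau>"
  have c: "c > 0" using m \<tau> by (simp add: c_def)
  obtain \<kappa> where \<kappa>: "\<kappa> > 0" "\<And>a b :: int. \<kappa> * ((of_int a)\<^sup>2 + (of_int b)\<^sup>2) \<le> (norm (of_int a * \<tau> + of_int b))\<^sup>2"
    using lattice_norm_ge[OF \<tau>] by blast
  obtain e where e: "e > 0" "\<And>a b :: int. e \<le> norm (z1 + (of_int a * \<tau> + of_int b))"
    using dist_lattice_bounded_below[OF \<tau> np] by blast
  define B where "B = norm (z1 + z2) + norm (z1 - z2)"
  define C where "C = norm (z1 - z2) * norm z1 + norm (z1 * z2)"
  show ?thesis
  proof (rule summable_on_int_pair_gaussian_bound)
    show "pi * c * \<kappa> > 0" using c \<kappa> by simp
    fix a b :: int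
    define l where "l = of_int a * \<tau> + of_int b"
    have "norm l \<le> norm (of_int a * \<tau>) + norm (of_int b :: complex)" unfolding l_def by (rule norm_triangle_ineq)
    also have "\<dots> \<le> (norm \<tau> + 1) * (\<bar>of_int a\<bar> + \<bar>of_int b\<bar>)"
      by (simp add: norm_mult algebra_simps)
    finally have l_le: "norm l \<le> (norm \<tau> + 1) * (\<bar>of_int a\<bar> + \<bar>of_int b\<bar>)" .
    define X where "X = (z1 + z2) * cnj l + cnj (z1 - z2) * (z1 + l) + z1 * z2"
    have "norm X \<le> norm ((z1 + z2) * cnj l) + norm (cnj (z1 - z2) * (z1 + l)) + norm (z1 * z2)"
      unfolding X_def by (intro order.trans[OF norm_triangle_ineq] add_mono order.refl)
    also have "norm (cnj (z1 - z2) * (z1 + l)) \<le> norm (z1 - z2) * (norm z1 + norm l)"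
      unfolding norm_mult complex_mod_cnj by (intro mult_left_mono norm_triangle_ineq) auto
    also have "norm ((z1 + z2) * cnj l) = norm (z1 + z2) * norm l"
      by (simp only: norm_mult complex_mod_cnj)
    finally have "norm X \<le> B * norm l + C" by (simp add: B_def C_def algebra_simps)
    also have "B * norm l \<le> B * ((norm \<tau> + 1) * (\<bar>of_int a\<bar> + \<bar>of_int b\<bar>))"
      by (intro mult_left_mono l_le) (auto simp: B_def)
    finally have X: "- Re X \<le> B * ((norm \<tau> + 1) * (\<bar>of_int a\<bar> + \<bar>of_int b\<bar>)) + C"
      using abs_Re_le_cmod[of X] by linarith
    have ll: "l * cnj l = of_real ((norm l)\<^sup>2)" using complex_norm_square[of l] by simp
    have "lattice_kernel c z1 z2 l = exp (- of_real (pi * c) * (of_real ((norm l)\<^sup>2) + X)) / (z1 + l)"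
      unfolding lattice_kernel_def X_def ll by (simp only: add.assoc)
    hence "norm (lattice_kernel c z1 z2 l) = exp (pi * c * (- (norm l)\<^sup>2 - Re X)) / norm (z1 + l)"
      by (simp add: norm_divide norm_exp_eq_Re algebra_simps)
    also have "\<dots> \<le> exp (pi * c * (- \<kappa> * ((of_int a)\<^sup>2 + (of_int b)\<^sup>2) + (B * ((norm \<tau> + 1) * (\<bar>of_int a\<bar> + \<bar>of_int b\<bar>)) + C))) / e"
      using c \<kappa>(2)[of a b] X e by (intro frac_le iffD2[OF exp_le_cancel_iff] mult_left_mono) (auto simp: l_def)
    also have "\<dots> = exp (pi * c * C) / e * exp (- (pi * c * \<kappa>) * ((of_int a)\<^sup>2 + (of_int b)\<^sup>2) + pi * c * B * (norm \<tau> + 1) * (\<bar>of_int a\<bar> + \<bar>of_int b\<bar>))"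
      by (simp add: mult_exp_exp algebra_simps)
    finally show "norm (case (a, b) of (a, b) \<Rightarrow> lattice_term \<epsilon> m s \<tau> z1 z2 a b) \<le>
       exp (pi * c * C) / e * exp (- (pi * c * \<kappa>) * ((of_int a)\<^sup>2 + (of_int b)\<^sup>2) + pi * c * B * (norm \<tau> + 1) * (\<bar>of_int a\<bar> + \<bar>of_int b\<bar>))"
      by (simp add: lattice_term_def norm_mult norm_power_int \<epsilon> norm_ee l_def c_def)
  qed
qed

text \<open>The numerator of the \<open>a\<close>-th summand of \<open>Phi\<close>, which is also
  the part of the lattice term that does not involve \<open>b\<close> once the square is
  completed.\<close>

definition row_factor :: "complex \<Rightarrow> real \<Rightarrow> real \<Rightarrow> complex \<Rightarrow> complex \<Rightarrow> complex \<Rightarrow> int \<Rightarrow> complex" where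
  "row_factor \<epsilon> m s \<tau> z1 z2 a = \<epsilon> powi a * ee (of_real m * of_int a * (z1 + z2)) * ee (\<tau> * of_real m * (of_int a)\<^sup>2)
     * ee (of_real s * (z1 + of_int a * \<tau>))"

text \<open>
  The summand of \<open>Phi_add\<close> in the indices \<open>a = l - k\<close> and \<open>i = d + 2mk\<close>, where \<open>n = j + 2mk\<close> and \<open>l\<close> are the
  summation indices of \<open>R\<close> and \<open>Theta\<close> and \<open>j = s + d\<close>.
\<close>

definition correction_term :: "complex \<Rightarrow> real \<Rightarrow> real \<Rightarrow> complex \<Rightarrow> complex \<Rightarrow> complex \<Rightarrow> int \<Rightarrow> int \<Rightarrow> complex" where
  "correction_term \<epsilon> m s \<tau> z1 z2 a i = row_factor \<epsilon> m s \<tau> z1 z2 a *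
     (of_real ((if i \<ge> 0 then 1 else -1) - EE ((of_int i - (m / Im \<tau> * Im (z1 - z2) - s)) / sqrt (m / Im \<tau>)))
      * ee (of_int i * (z1 + of_int a * \<tau>)))"

text \<open>The exponential factors alone have the indefinite exponent
  \<open>m A\<^sup>2 + A I\<close>. The decay of sign minus \<open>EE\<close> in \<open>I\<close>
  supplies \<open>I\<^sup>2 / m\<close> and makes the form
  \<open>2 m A\<^sup>2 + 2 A I + I\<^sup>2 / m\<close> positive definite.\<close>

lemma summable_correction_term:
  assumes m: "m > 0" and \<tau>: "Im \<tau> > 0" and \<epsilon>: "norm \<epsilon> = 1"
  shows "(\<lambda>(a, i). correction_term \<epsilon> m s \<tau> z1 z2 a i) summable_on UNIV"
proof -
  define v where "v = Im \<tau>"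
  define c where "c = m / v"
  define \<eta> where "\<eta> = c * Im (z1 - z2) - s"
  have v: "v > 0" using \<tau> by (simp add: v_def)
  have c: "c > 0" using m v by (simp add: c_def)
  \<comment> \<open>Coefficients of a diagonal form that can be split off: the remainder is
    \<open>((5 m A + 3 I)\<^sup>2 + I\<^sup>2) / (15 m)\<close>.\<close>
  define \<kappa> where "\<kappa> = min (m / 3) (1 / (3 * m))"
  define \<beta> where "\<beta> = 2 * pi * (m * \<bar>Im (z1 + z2)\<bar> + \<bar>s\<bar> * v + \<bar>Im z1\<bar> + \<bar>\<eta>\<bar> / c)"
  \<comment> \<open>No \<open>\<eta>\<close> appears because the constant
    \<open>exp (pi * \<eta>\<^sup>2 / c)\<close> of the tail bound cancels the
    \<open>\<eta>\<^sup>2\<close> in the expanded Gaussian.\<close>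
  define C where "C = 2 * exp (- (2 * pi * s * Im z1))"
  show ?thesis
  proof (rule summable_on_int_pair_gaussian_bound)
    show "pi * v * \<kappa> > 0" using v m by (simp add: \<kappa>_def)
    fix a i :: int
    define A I :: real where "A = of_int a" and "I = of_int i"
    define N where "N = norm (row_factor \<epsilon> m s \<tau> z1 z2 a) * norm (ee (of_int i * (z1 + of_int a * \<tau>)))"
    have N: "N = exp (- (2 * pi) * (m * A * Im (z1 + z2) + v * m * A\<^sup>2 + (s + I) * (Im z1 + A * v)))"
      unfolding N_def by (simp add: row_factor_def norm_mult norm_power_int \<epsilon> norm_ee mult_exp_exp A_def I_def v_def power2_eq_square algebra_simps)
    have "norm (correction_term \<epsilon> m s \<tau> z1 z2 a i) = N * \<bar>(if i \<ge> 0 then 1 else -1) - EE ((of_int i - \<eta>) / sqrt c)\<bar>"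
      unfolding correction_term_def norm_mult norm_of_real N_def c_def \<eta>_def v_def by (simp only: mult_ac)
    also have "\<dots> \<le> N * (2 * exp (pi * \<eta>\<^sup>2 / c) * exp (- pi * (of_int i - \<eta>)\<^sup>2 / c))"
      by (intro mult_left_mono abs_sign_minus_EE_le c) (auto simp: N_def)
    also have "\<dots> = C * exp (- (pi * v) * (2 * m * A\<^sup>2 + 2 * A * I + I\<^sup>2 / m)
        + 2 * pi * (A * (- m * Im (z1 + z2) - s * v) + I * (\<eta> / c - Im z1)))"
      unfolding N C_def mult_exp_exp mult.assoc mult.left_commute[of "exp _" 2]
      by (rule arg_cong[of _ _ "\<lambda>x. 2 * exp x"])
         (use m v in \<open>simp add: I_def[symmetric] c_def power2_eq_square field_simps\<close>)
    also have "\<dots> \<le> C * exp (- (pi * v * \<kappa>) * (A\<^sup>2 + I\<^sup>2) + \<beta> * (\<bar>A\<bar> + \<bar>I\<bar>))"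
    proof -
      have "2 * m * A\<^sup>2 + 2 * A * I + I\<^sup>2 / m = m / 3 * A\<^sup>2 + 1 / (3 * m) * I\<^sup>2 + ((5 * m * A + 3 * I)\<^sup>2 + I\<^sup>2) / (15 * m)"
        using m by (simp add: power2_eq_square field_simps)
      also have "\<dots> \<ge> \<kappa> * A\<^sup>2 + \<kappa> * I\<^sup>2 + 0"
        using m by (intro add_mono mult_right_mono) (auto simp: \<kappa>_def)
      finally have "pi * v * (\<kappa> * (A\<^sup>2 + I\<^sup>2)) \<le> pi * v * (2 * m * A\<^sup>2 + 2 * A * I + I\<^sup>2 / m)"
        using v by (intro mult_left_mono) (auto simp: algebra_simps)
      moreover have "2 * pi * (A * (- m * Im (z1 + z2) - s * v) + I * (\<eta> / c - Im z1)) \<le> \<beta> * (\<bar>A\<bar> + \<bar>I\<bar>)"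
      proof -
        define \<gamma> where "\<gamma> = m * \<bar>Im (z1 + z2)\<bar> + \<bar>s\<bar> * v + \<bar>Im z1\<bar> + \<bar>\<eta>\<bar> / c"
        have "\<bar>- m * Im (z1 + z2) - s * v\<bar> \<le> \<gamma>"
        proof -
          have "\<bar>- m * Im (z1 + z2) - s * v\<bar> \<le> \<bar>m * Im (z1 + z2)\<bar> + \<bar>s * v\<bar>" by linarith
          also have "\<dots> \<le> \<gamma>" using m v c by (simp add: \<gamma>_def abs_mult)
          finally show ?thesis .
        qed
        hence 1: "A * (- m * Im (z1 + z2) - s * v) \<le> \<bar>A\<bar> * \<gamma>"
          by (metis abs_ge_self abs_mult abs_ge_zero mult_left_mono order_trans)
        have "\<bar>\<eta> / c - Im z1\<bar> \<le> \<gamma>"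
        proof -
          have "\<bar>\<eta> / c - Im z1\<bar> \<le> \<bar>\<eta> / c\<bar> + \<bar>Im z1\<bar>" by linarith
          also have "\<dots> \<le> \<gamma>" using m v c by (simp add: \<gamma>_def)
          finally show ?thesis .
        qed
        hence 2: "I * (\<eta> / c - Im z1) \<le> \<bar>I\<bar> * \<gamma>"
          by (metis abs_ge_self abs_mult abs_ge_zero mult_left_mono order_trans)
        have "2 * pi * (A * (- m * Im (z1 + z2) - s * v) + I * (\<eta> / c - Im z1)) \<le> 2 * pi * (\<bar>A\<bar> * \<gamma> + \<bar>I\<bar> * \<gamma>)"
          by (intro mult_left_mono add_mono 1 2) auto
        moreover have "\<beta> = 2 * pi * \<gamma>" by (simp only: \<beta>_def \<gamma>_def)
        ultimately show ?thesis by (simp add: algebra_simps)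
      qed
      ultimately show ?thesis
        by (intro mult_left_mono iffD2[OF exp_le_cancel_iff]) (auto simp: C_def algebra_simps)
    qed
    finally show "norm (case (a, i) of (a, i) \<Rightarrow> correction_term \<epsilon> m s \<tau> z1 z2 a i) \<le>
       C * exp (- (pi * v * \<kappa>) * ((of_int a)\<^sup>2 + (of_int i)\<^sup>2) + \<beta> * (\<bar>of_int a\<bar> + \<bar>of_int i\<bar>))"
      by (simp add: A_def I_def)
  qed
qed

section \<open>Reindexing the correction as a double sum\<close>

lemma power_int_sign_diff:
  fixes \<epsilon> :: complex
  assumes "\<epsilon> \<in> {1, -1}"
  shows "\<epsilon> powi (l - k) = \<epsilon> powi k * \<epsilon> powi l"
proof -
  have "\<epsilon> powi k * \<epsilon> powi k = 1"
    using assms by (auto simp flip: power_int_mult_distrib)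
  moreover have "\<epsilon> powi (l - k) * \<epsilon> powi k = \<epsilon> powi l"
    using assms by (subst power_int_add[symmetric]) auto
  ultimately show ?thesis
    by (metis mult.commute mult.left_commute mult.right_neutral)
qed

text \<open>Division with remainder by \<open>M = 2 m\<close> merges the residue \<open>d\<close>
  and the index \<open>k\<close> of \<open>R\<close> into one integer \<open>i\<close>. The
  exponents of \<open>R\<close> and \<open>Theta\<close> together depend on \<open>l - k\<close> and
  \<open>i\<close> only.\<close>

lemma Phi_add_eq_infsum:
  assumes M: "2 * m \<in> \<int>" and m: "m > 0" and s: "2 * s \<in> \<int>" and \<tau>: "Im \<tau> > 0" and \<epsilon>: "\<epsilon> \<in> {1, -1}"
  shows "Phi_add \<epsilon> m s \<tau> z1 z2 = (\<Sum>\<^sub>\<infinity>(a, i). correction_term \<epsilon> m s \<tau> z1 z2 a i)"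
proof -
  obtain M :: int where M: "2 * m = of_int M" using M by (blast elim: Ints_cases)
  have M0: "M > 0" using M m of_int_0_less_iff[of M, where ?'a = real] by linarith
  define u where "u = (z1 - z2) / 2"
  define sg where "sg = (\<lambda>i::int. (if i \<ge> 0 then 1 else -1) - EE ((of_int i - (m / Im \<tau> * Im (z1 - z2) - s)) / sqrt (m / Im \<tau>)))"
  define Rt where "Rt = (\<lambda>d k. \<epsilon> powi k * of_real (sg (d + M * k))
       * ee (- ((of_real (s + of_int d) + 2 * of_real m * of_int k)\<^sup>2 / (4 * of_real m)) * \<tau>
             + (of_real (s + of_int d) + 2 * of_real m * of_int k) * u))"
  define Tt where "Tt = (\<lambda>d l::int. \<epsilon> powi l * ee (of_real m * (z1 + z2) * (of_int l + of_real (s + of_int d) / (2 * of_real m)))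
       * ee (\<tau> * (of_real m * (of_int l + of_real (s + of_int d) / (2 * of_real m))\<^sup>2)))"
  define F where "F = (\<lambda>d k l. correction_term \<epsilon> m s \<tau> z1 z2 (l - k) (d + M * k))"

  have R: "R \<epsilon> (s + of_int d) m \<tau> u = (\<Sum>\<^sub>\<infinity>k. Rt d k)" if d: "d \<in> {0..<M}" for d
  proof -
    define j where "j = s + of_int d"
    have set_eq: "{n::real. 2 * n \<in> \<int> \<and> (n - j) / (2 * m) \<in> \<int>} = range (\<lambda>k::int. j + 2 * m * of_int k)"
    proof (intro equalityI subsetI)
      fix n assume "n \<in> {n::real. 2 * n \<in> \<int> \<and> (n - j) / (2 * m) \<in> \<int>}"
      then obtain k :: int where "(n - j) / (2 * m) = of_int k" by (blast elim: Ints_cases)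
      hence "n = j + 2 * m * of_int k" using m by (simp add: field_simps)
      thus "n \<in> range (\<lambda>k::int. j + 2 * m * of_int k)" by blast
    next
      fix n assume "n \<in> range (\<lambda>k::int. j + 2 * m * of_int k)"
      then obtain k :: int where k: "n = j + 2 * m * of_int k" by blast
      have "2 * n = 2 * s + of_int (2 * d + 2 * M * k)"
        unfolding k M by (simp add: j_def)
      moreover have "2 * s + of_int (2 * d + 2 * M * k) \<in> \<int>" using s by (intro Ints_add) auto
      ultimately show "n \<in> {n::real. 2 * n \<in> \<int> \<and> (n - j) / (2 * m) \<in> \<int>}"
        using k m by simp
    qed
    have inj: "inj (\<lambda>k::int. j + 2 * m * of_int k)" using m by (auto simp: inj_on_def)
    have "R \<epsilon> j m \<tau> u = (\<Sum>\<^sub>\<infinity>k. Rt d k)"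
      unfolding R_def set_eq infsum_reindex[OF inj] o_def
    proof (rule infsum_cong)
      fix k :: int
      define n where "n = j + 2 * m * of_int k"
      have 1: "\<lfloor>(n - j) / (2 * m)\<rfloor> = k" using m by (simp add: n_def)
      have n: "n = s + of_int (d + M * k)" by (simp add: n_def j_def M)
      \<comment> \<open>The offset 1/2 keeps the argument of \<open>sgn\<close> away from 0; as
        \<open>M \<ge> 1\<close>, its sign is that of \<open>k \<ge> 0\<close>, which for
        \<open>0 \<le> d < M\<close> is also that of \<open>d + M * k \<ge> 0\<close>.\<close>
      have "n - 1 / 2 - j + 2 * m = of_int (M * (k + 1)) - 1 / 2" by (simp add: n_def algebra_simps M[symmetric])
      moreover have "of_int (M * (k + 1)) - 1 / 2 > (0::real)" if "k \<ge> 0"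
      proof -
        have "M * (k + 1) \<ge> 1" using that M0 by (simp add: int_one_le_iff_zero_less)
        hence "of_int (M * (k + 1)) \<ge> (1::real)" by (simp only: of_int_1_le_iff)
        thus ?thesis by linarith
      qed
      moreover have "of_int (M * (k + 1)) - 1 / 2 < (0::real)" if "k < 0"
      proof -
        have "M * (k + 1) \<le> 0" using that M0 by (simp add: mult_le_0_iff)
        hence "of_int (M * (k + 1)) \<le> (0::real)" by (simp only: of_int_le_0_iff)
        thus ?thesis by linarith
      qed
      moreover have "d + M * k \<ge> 0 \<longleftrightarrow> k \<ge> 0"
      proof
        assume "d + M * k \<ge> 0"
        hence "M * (k + 1) > 0" using d by (simp add: algebra_simps)
        thus "k \<ge> 0" using M0 by (simp add: zero_less_mult_iff)
      qed (use d M0 in auto)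
      ultimately have 2: "sgn (n - 1 / 2 - j + 2 * m) = (if d + M * k \<ge> 0 then 1 else -1)"
        by (cases "k \<ge> 0") (auto simp: not_le)
      have "sqrt (Im \<tau> / m) = 1 / sqrt (m / Im \<tau>)" by (simp add: real_sqrt_divide)
      hence "psi m n \<tau> u = (n - 2 * m * Im u / Im \<tau>) / sqrt (m / Im \<tau>)" by (simp only: psi_def) simp
      also have "n - 2 * m * Im u / Im \<tau> = of_int (d + M * k) - (m / Im \<tau> * Im (z1 - z2) - s)"
        unfolding n u_def by simp
      finally have 3: "sgn (n - 1 / 2 - j + 2 * m) - EE (psi m n \<tau> u) = sg (d + M * k)"
        unfolding 2 sg_def by simp
      have 4: "exp (- complex_of_real pi * \<i> * of_real (n ^ 2) / of_real (2 * m) * \<tau> + 2 * complex_of_real pi * \<i> * of_real n * u)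
         = ee (- ((of_real j + 2 * of_real m * of_int k)\<^sup>2 / (4 * of_real m)) * \<tau> + (of_real j + 2 * of_real m * of_int k) * u)"
        unfolding ee_def n_def by (intro arg_cong[of _ _ exp]) (use m in \<open>simp add: field_simps\<close>)
      show "\<epsilon> powi \<lfloor>(j + 2 * m * of_int k - j) / (2 * m)\<rfloor>
        * complex_of_real (sgn (j + 2 * m * of_int k - 1/2 - j + 2 * m) - EE (psi m (j + 2 * m * of_int k) \<tau> u))
        * exp (- complex_of_real pi * \<i> * of_real ((j + 2 * m * of_int k) ^ 2) / of_real (2 * m) * \<tau>
               + 2 * complex_of_real pi * \<i> * of_real (j + 2 * m * of_int k) * u) = Rt d k"
        unfolding n_def[symmetric] 1 3 4 by (simp add: Rt_def j_def)
    qed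
    thus ?thesis by (simp add: j_def)
  qed

  have T: "Theta \<epsilon> (s + of_int d) m \<tau> (z1 + z2) = (\<Sum>\<^sub>\<infinity>l. Tt d l)" for d
    unfolding Theta_def Tt_def qp_eq_ee by (intro infsum_cong) simp

  have RT: "Rt d k * Tt d l = F d k l" for d k l
  proof -
    define j where "j = complex_of_real (s + of_int d)"
    have j: "of_real s + of_int (d + M * k) = j + 2 * of_real m * of_int k"
    proof -
      have "2 * complex_of_real m = of_int M" using arg_cong[OF M, of complex_of_real] by simp
      thus ?thesis by (simp add: j_def)
    qed
    have mm: "of_real m \<noteq> (0::complex)" using m by simp
    have exponents: "(- ((j + 2 * \<mu> * k)\<^sup>2 / (4 * \<mu>)) * \<tau> + (j + 2 * \<mu> * k) * u)
        + \<mu> * (z1 + z2) * (l + j / (2 * \<mu>)) + \<tau> * (\<mu> * (l + j / (2 * \<mu>))\<^sup>2)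
        = \<mu> * (l - k) * (z1 + z2) + \<tau> * \<mu> * (l - k)\<^sup>2 + (j + 2 * \<mu> * k) * (z1 + (l - k) * \<tau>)"
      if "\<mu> \<noteq> 0" for \<mu> k l :: complex
    proof -
      \<comment> \<open>The term \<open>j\<^sup>2 / (4 \<mu>)\<close> enters with opposite signs
        from \<open>R\<close> and \<open>Theta\<close> and cancels; the halves
        \<open>j (z1 - z2) / 2\<close> and \<open>j (z1 + z2) / 2\<close> add up to
        \<open>j z1\<close>.\<close>
      define q where "q = j\<^sup>2 / (4 * \<mu>)"
      have 1: "(j + 2 * \<mu> * k)\<^sup>2 / (4 * \<mu>) = q + j * k + \<mu> * k\<^sup>2"
        using that by (simp add: q_def power2_eq_square divide_simps) algebra
      have 2: "\<mu> * (l + j / (2 * \<mu>))\<^sup>2 = \<mu> * l\<^sup>2 + l * j + q"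
        using that by (simp add: q_def power2_eq_square divide_simps) algebra
      have 3: "\<mu> * (z1 + z2) * (l + j / (2 * \<mu>)) = (z1 + z2) * (\<mu> * l) + (z1 + z2) * j / 2"
        using that by (simp add: divide_simps) algebra
      show ?thesis unfolding 1 2 3 u_def
        by (simp add: power2_eq_square algebra_simps diff_divide_distrib add_divide_distrib)
    qed
    have "F d k l = \<epsilon> powi (l - k) * of_real (sg (d + M * k)) *
       (ee (of_real m * of_int (l - k) * (z1 + z2)) * ee (\<tau> * of_real m * (of_int (l - k))\<^sup>2)
         * ee (of_real s * (z1 + of_int (l - k) * \<tau>)) * ee (of_int (d + M * k) * (z1 + of_int (l - k) * \<tau>)))"
      unfolding F_def correction_term_def row_factor_def sg_def by (simp only: mult_ac)
    also have "\<dots> = \<epsilon> powi (l - k) * of_real (sg (d + M * k)) *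
       ee (of_real m * of_int (l - k) * (z1 + z2) + \<tau> * of_real m * (of_int (l - k))\<^sup>2 + (of_real s + of_int (d + M * k)) * (z1 + of_int (l - k) * \<tau>))"
      by (simp only: ee_add distrib_right[of "of_real s"] mult.assoc)
    also have "of_real m * of_int (l - k) * (z1 + z2) + \<tau> * of_real m * (of_int (l - k))\<^sup>2 + (of_real s + of_int (d + M * k)) * (z1 + of_int (l - k) * \<tau>)
       = (- ((j + 2 * of_real m * of_int k)\<^sup>2 / (4 * of_real m)) * \<tau> + (j + 2 * of_real m * of_int k) * u)
        + of_real m * (z1 + z2) * (of_int l + j / (2 * of_real m)) + \<tau> * (of_real m * (of_int l + j / (2 * of_real m))\<^sup>2)"
      unfolding j of_int_diff by (rule exponents[OF mm, symmetric])
    finally have "F d k l = (\<epsilon> powi k * \<epsilon> powi l) * of_real (sg (d + M * k)) * (ee (- ((j + 2 * of_real m * of_int k)\<^sup>2 / (4 * of_real m)) * \<tau> + (j + 2 * of_real m * of_int k) * u)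
        * ee (of_real m * (z1 + z2) * (of_int l + j / (2 * of_real m))) * ee (\<tau> * (of_real m * (of_int l + j / (2 * of_real m))\<^sup>2)))"
      by (simp only: power_int_sign_diff[OF \<epsilon>] ee_add)
    thus ?thesis unfolding Rt_def Tt_def j_def by (simp only: mult_ac)
  qed

  have J: "{j::real. j - s \<in> \<int> \<and> s \<le> j \<and> j < s + 2 * m} = (\<lambda>d::int. s + of_int d) ` {0..<M}"
  proof (intro equalityI subsetI)
    fix j assume j: "j \<in> {j::real. j - s \<in> \<int> \<and> s \<le> j \<and> j < s + 2 * m}"
    then obtain d :: int where d: "j - s = of_int d" by (blast elim: Ints_cases)
    hence "j = s + of_int d" by simp
    thus "j \<in> (\<lambda>d::int. s + of_int d) ` {0..<M}" using j M by auto
  qed (use M in auto)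
  have "inj_on (\<lambda>d::int. s + of_int d) {0..<M}" by (auto simp: inj_on_def)
  \<comment> \<open>Constants may be pulled out of \<open>infsum\<close> unconditionally, so the
    product is an iterated sum at once; convergence enters only in the rearrangement below.\<close>
  moreover have "(\<Sum>\<^sub>\<infinity>k. Rt d k) * (\<Sum>\<^sub>\<infinity>l. Tt d l) = (\<Sum>\<^sub>\<infinity>k. \<Sum>\<^sub>\<infinity>l. F d k l)" for d
    by (subst infsum_cmult_left'[symmetric]) (simp only: infsum_cmult_right'[symmetric] RT)
  ultimately have "Phi_add \<epsilon> m s \<tau> z1 z2 = (\<Sum>d\<in>{0..<M}. \<Sum>\<^sub>\<infinity>k. \<Sum>\<^sub>\<infinity>l. F d k l)"
    unfolding Phi_add_def J u_def[symmetric] by (simp add: sum.reindex R T)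
  also have "\<dots> = (\<Sum>\<^sub>\<infinity>(a, i). correction_term \<epsilon> m s \<tau> z1 z2 a i)"
  proof -
    have sum: "(\<lambda>(a, i). correction_term \<epsilon> m s \<tau> z1 z2 a i) summable_on UNIV"
      by (rule summable_correction_term) (use m \<tau> \<epsilon> in auto)
    have inner: "(\<lambda>(k, l). F d k l) summable_on (UNIV \<times> UNIV)" for d
    proof -
      define \<phi> where "\<phi> = (\<lambda>(k, l). (l - k, d + M * k))"
      have "inj \<phi>" using M0 by (auto simp: \<phi>_def inj_on_def)
      moreover have "(\<lambda>(a, i). correction_term \<epsilon> m s \<tau> z1 z2 a i) summable_on range \<phi>"
        by (rule summable_on_subset_banach[OF sum]) auto
      ultimately have "(\<lambda>(a, i). correction_term \<epsilon> m s \<tau> z1 z2 a i) \<circ> \<phi> summable_on UNIV"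
        by (simp add: summable_on_reindex)
      thus ?thesis by (simp add: o_def \<phi>_def F_def case_prod_unfold)
    qed
    \<comment> \<open>Quotient and remainder of \<open>i\<close> by \<open>M\<close> recover
      \<open>k\<close> and \<open>d\<close>, and then \<open>l = a + k\<close>.\<close>
    have bij: "(\<lambda>(a, i). correction_term \<epsilon> m s \<tau> z1 z2 a i) summable_on UNIV \<longleftrightarrow>
          (\<lambda>(d, kl). case kl of (k, l) \<Rightarrow> F d k l) summable_on ({0..<M} \<times> (UNIV \<times> UNIV))"
      by (rule summable_on_reindex_bij_witness[of _ "\<lambda>(d, k, l). (l - k, d + M * k)" "\<lambda>(a, i). (i mod M, i div M, a + i div M)"])
         (use M0 in \<open>auto simp: F_def\<close>)
    have "(\<Sum>\<^sub>\<infinity>(a, i). correction_term \<epsilon> m s \<tau> z1 z2 a i) =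
          (\<Sum>\<^sub>\<infinity>(d, kl)\<in>{0..<M} \<times> (UNIV \<times> UNIV). case kl of (k, l) \<Rightarrow> F d k l)"
      by (rule infsum_reindex_bij_witness[of _ "\<lambda>(d, k, l). (l - k, d + M * k)" "\<lambda>(a, i). (i mod M, i div M, a + i div M)"])
         (use M0 in \<open>auto simp: F_def\<close>)
    also have "\<dots> = (\<Sum>\<^sub>\<infinity>d\<in>{0..<M}. \<Sum>\<^sub>\<infinity>(k, l)\<in>UNIV \<times> UNIV. F d k l)"
      using sum bij by (intro infsum_Sigma'_banach[symmetric]) auto
    also have "\<dots> = (\<Sum>\<^sub>\<infinity>d\<in>{0..<M}. \<Sum>\<^sub>\<infinity>k. \<Sum>\<^sub>\<infinity>l. F d k l)"
      by (intro infsum_cong infsum_Sigma'_banach[symmetric] inner)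
    finally show ?thesis by simp
  qed
  finally show ?thesis .
qed

text \<open>Completing the square around \<open>\<zeta> = z1 + a \<tau>\<close> exhibits the row as
  \<open>row_factor\<close> times the sum in \<open>gaussian_partial_fractions\<close>. The
  frequency \<open>\<eta>\<close> collects \<open>c * Im (z1 - z2)\<close> from the kernel and
  \<open>- s\<close> from the character in \<open>b\<close>; the pole term becomes the summand of
  \<open>Phi\<close>.\<close>

lemma infsum_lattice_row:
  assumes m: "m > 0" and \<tau>: "Im \<tau> > 0" and np: "\<And>b :: int. z1 + (of_int a * \<tau> + of_int b) \<noteq> 0"
  shows "(\<Sum>\<^sub>\<infinity>b. lattice_term \<epsilon> m s \<tau> z1 z2 a b) =
         of_real pi * \<i> * (\<Sum>\<^sub>\<infinity>i. correction_term \<epsilon> m s \<tau> z1 z2 a i)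
           - 2 * of_real pi * \<i> * (row_factor \<epsilon> m s \<tau> z1 z2 a / (1 - ee (z1 + of_int a * \<tau>)))"
proof -
  define v where "v = Im \<tau>"
  define c where "c = m / v"
  define \<eta> where "\<eta> = c * Im (z1 - z2) - s"
  define \<zeta> where "\<zeta> = z1 + of_int a * \<tau>"
  have v: "v > 0" using \<tau> by (simp add: v_def)
  have c: "c > 0" using m v by (simp add: c_def)
  have mc: "m = c * v" using v by (simp add: c_def)
  have \<zeta>: "\<zeta> \<notin> \<int>"
  proof
    assume "\<zeta> \<in> \<int>"
    then obtain n where "\<zeta> = of_int n" by (blast elim: Ints_cases)
    thus False using np[of "-n"] by (simp add: \<zeta>_def algebra_simps)
  qed
  have "lattice_term \<epsilon> m s \<tau> z1 z2 a b = row_factor \<epsilon> m s \<tau> z1 z2 a *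
      (exp (- of_real (pi * c) * (of_int b + \<zeta>)\<^sup>2) * ee (of_real \<eta> * (of_int b + \<zeta>)) / (of_int b + \<zeta>))" for b
  proof -
    define A B :: real where "A = of_int a" and "B = of_int b"
    have AB: "of_int a = complex_of_real A" "of_int b = complex_of_real B" by (simp_all add: A_def B_def)
    have "ee (- of_real s * of_int b) * ee (- of_real m * of_int a * of_int b) *
       exp (- of_real (pi * c) * ((of_int a * \<tau> + of_int b) * cnj (of_int a * \<tau> + of_int b) + (z1 + z2) * cnj (of_int a * \<tau> + of_int b)
          + cnj (z1 - z2) * (z1 + (of_int a * \<tau> + of_int b)) + z1 * z2))
      = ee (of_real m * of_int a * (z1 + z2)) * ee (\<tau> * of_real m * (of_int a)\<^sup>2) * ee (of_real s * \<zeta>) *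
         (exp (- of_real (pi * c) * (of_int b + \<zeta>)\<^sup>2) * ee (of_real \<eta> * (of_int b + \<zeta>)))"
      unfolding ee_def mult_exp_exp AB \<zeta>_def \<eta>_def mc v_def
      by (intro arg_cong[of _ _ exp]) (simp add: complex_eq_iff power2_eq_square algebra_simps)
    moreover have "z1 + (of_int a * \<tau> + of_int b) = of_int b + \<zeta>" by (simp add: \<zeta>_def)
    ultimately show ?thesis
      unfolding lattice_term_def lattice_kernel_def row_factor_def c_def[symmetric] v_def[symmetric] \<zeta>_def[symmetric]
      by (simp only: mult.assoc times_divide_eq_right)
  qed
  hence "(\<Sum>\<^sub>\<infinity>b. lattice_term \<epsilon> m s \<tau> z1 z2 a b) = row_factor \<epsilon> m s \<tau> z1 z2 a *
      (\<Sum>\<^sub>\<infinity>b. exp (- of_real (pi * c) * (of_int b + \<zeta>)\<^sup>2) * ee (of_real \<eta> * (of_int b + \<zeta>)) / (of_int b + \<zeta>))"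
    by (simp only: infsum_cmult_right')
  also have "\<dots> = row_factor \<epsilon> m s \<tau> z1 z2 a *
      (of_real pi * \<i> * (\<Sum>\<^sub>\<infinity>k::int. of_real ((if k \<ge> 0 then 1 else -1) - EE ((of_int k - \<eta>) / sqrt c)) * ee (of_int k * \<zeta>))
           - 2 * of_real pi * \<i> / (1 - ee \<zeta>))"
    by (subst gaussian_partial_fractions[OF c \<zeta>]) (rule refl)
  also have "\<dots> = of_real pi * \<i> * (\<Sum>\<^sub>\<infinity>i. correction_term \<epsilon> m s \<tau> z1 z2 a i)
           - 2 * of_real pi * \<i> * (row_factor \<epsilon> m s \<tau> z1 z2 a / (1 - ee \<zeta>))"
    unfolding correction_term_def infsum_cmult_right' c_def[symmetric] v_def[symmetric] \<eta>_def[symmetric] \<zeta>_def[symmetric]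
    by (simp add: algebra_simps)
  finally show ?thesis by (simp add: \<zeta>_def)
qed

lemma tPhi_eq_lattice_sum:
  assumes M: "2 * m \<in> \<int>" and m: "m > 0" and s: "2 * s \<in> \<int>" and \<tau>: "Im \<tau> > 0" and \<epsilon>: "\<epsilon> \<in> {1, -1}"
  assumes np: "\<And>a b :: int. z1 + (of_int a * \<tau> + of_int b) \<noteq> 0"
  shows "tPhi \<epsilon> m s \<tau> z1 z2 = - 1 / (2 * of_real pi * \<i>) * (\<Sum>\<^sub>\<infinity>(a, b). lattice_term \<epsilon> m s \<tau> z1 z2 a b)"
proof -
  define P where "P = (\<lambda>a. row_factor \<epsilon> m s \<tau> z1 z2 a / (1 - ee (z1 + of_int a * \<tau>)))"
  define C where "C = (\<lambda>a. \<Sum>\<^sub>\<infinity>i. correction_term \<epsilon> m s \<tau> z1 z2 a i)"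
  define L where "L = (\<lambda>a. \<Sum>\<^sub>\<infinity>b. lattice_term \<epsilon> m s \<tau> z1 z2 a b)"
  have norm\<epsilon>: "norm \<epsilon> = 1" using \<epsilon> by auto
  have sumC: "(\<lambda>(a, i). correction_term \<epsilon> m s \<tau> z1 z2 a i) summable_on UNIV \<times> UNIV"
    using summable_correction_term[OF m \<tau> norm\<epsilon>] by simp
  have sumL: "(\<lambda>(a, b). lattice_term \<epsilon> m s \<tau> z1 z2 a b) summable_on UNIV \<times> UNIV"
    using summable_lattice_term[OF m \<tau> norm\<epsilon> np] by simp
  have C: "C summable_on UNIV"
    using summable_on_Sigma_banach[OF sumC] by (simp add: C_def)
  have L: "L summable_on UNIV"
    using summable_on_Sigma_banach[OF sumL] by (simp add: L_def)
  have "infsum C UNIV = (\<Sum>\<^sub>\<infinity>(a, i). correction_term \<epsilon> m s \<tau> z1 z2 a i)"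
    using infsum_Sigma'_banach[OF sumC] by (simp add: C_def)
  hence add: "Phi_add \<epsilon> m s \<tau> z1 z2 = infsum C UNIV"
    by (simp add: Phi_add_eq_infsum[OF M m s \<tau> \<epsilon>])
  have "Phi \<epsilon> m s \<tau> z1 z2 = infsum P UNIV"
    unfolding Phi_def P_def row_factor_def qp_eq_ee
    by (intro infsum_cong) (simp add: ee_add ring_distribs mult_ac)
  \<comment> \<open>Solving the row identity for \<open>P\<close> writes \<open>Phi\<close> as a
    combination of two summable families, so its convergence is inherited from the double
    sums.\<close>
  also have "P = (\<lambda>a. 1 / 2 * C a + - 1 / (2 * of_real pi * \<i>) * L a)"
  proof
    fix a
    have "L a = of_real pi * \<i> * C a - 2 * of_real pi * \<i> * P a"
      unfolding L_def C_def P_def by (rule infsum_lattice_row[OF m \<tau> np])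
    hence "- 1 / (2 * of_real pi * \<i>) * L a = - 1 / (2 * of_real pi * \<i>) * (of_real pi * \<i> * C a - 2 * of_real pi * \<i> * P a)"
      by simp
    also have "\<dots> = P a - 1 / 2 * C a"
      by (simp add: field_simps)
    finally show "P a = 1 / 2 * C a + - 1 / (2 * of_real pi * \<i>) * L a" by simp
  qed
  also have "infsum \<dots> UNIV = 1 / 2 * infsum C UNIV + - 1 / (2 * of_real pi * \<i>) * infsum L UNIV"
    by (subst infsum_add) (auto intro!: summable_on_cmult_right C L simp only: infsum_cmult_right')
  finally have "tPhi \<epsilon> m s \<tau> z1 z2 = - 1 / (2 * of_real pi * \<i>) * infsum L UNIV"
    by (simp add: tPhi_def add)
  also have "infsum L UNIV = (\<Sum>\<^sub>\<infinity>(a, b). lattice_term \<epsilon> m s \<tau> z1 z2 a b)"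
    using infsum_Sigma'_banach[OF sumL] by (simp add: L_def)
  finally show ?thesis .
qed

section \<open>Transformation laws\<close>

lemma ee_power_int: "ee x powi n = ee (of_int n * x)"
  by (simp add: ee_def exp_power_int mult_ac)

lemma ee_eqI: "x - y \<in> \<int> \<Longrightarrow> ee x = ee y"
  using ee_Ints[of "x - y"] by (simp add: ee_diff)

text \<open>Shifting \<open>l\<close> back by \<open>\<mu>\<close> keeps the denominator
  \<open>z1 + l\<close> fixed, and the quadratic part of the exponent is unchanged; only terms
  affine in \<open>l\<close> and \<open>cnj l\<close> remain.\<close>

lemma lattice_kernel_shift:
  "lattice_kernel c (z1 + \<mu>) (z2 + \<nu>) (l - \<mu>) =
     exp (- of_real (pi * c) * (\<nu> * cnj l - cnj \<nu> * l + (\<nu> - cnj \<nu>) * z1 + (\<mu> - cnj \<mu>) * z2 + (\<mu> - cnj \<mu>) * \<nu>))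
     * lattice_kernel c z1 z2 l"
  unfolding lattice_kernel_def times_divide_eq_right mult_exp_exp
  by (intro arg_cong2[of _ _ _ _ "(/)"] arg_cong[of _ _ exp]) (simp_all add: algebra_simps)

text \<open>Every term of the exponent except \<open>z1 * z2\<close> is a holomorphic factor times
  an antiholomorphic one, so the rescaling by \<open>(norm \<tau>)\<^sup>2\<close> cancels exactly.
  The defect of \<open>z1 * z2\<close> is the exponential automorphy factor, and the denominator
  contributes the weight \<open>\<tau>\<close>.\<close>

lemma lattice_kernel_inversion:
  assumes "\<tau> \<noteq> 0"
  shows "lattice_kernel (c * (norm \<tau>)\<^sup>2) (z1 / \<tau>) (z2 / \<tau>) (l / \<tau>) =
           \<tau> * exp (2 * of_real pi * \<i> * of_real (c * Im \<tau>) / \<tau> * z1 * z2) * lattice_kernel c z1 z2 l"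
proof -
  define t where "t = cnj \<tau>"
  have t: "t \<noteq> 0" using assms by (simp add: t_def)
  have norm: "of_real ((norm \<tau>)\<^sup>2) = \<tau> * t" unfolding t_def by (rule complex_norm_square)
  have Im: "2 * \<i> * of_real (Im \<tau>) = \<tau> - t" by (simp add: t_def complex_eq_iff)
  have "- of_real (pi * (c * (norm \<tau>)\<^sup>2)) * (l / \<tau> * cnj (l / \<tau>) + (z1 / \<tau> + z2 / \<tau>) * cnj (l / \<tau>)
           + cnj (z1 / \<tau> - z2 / \<tau>) * (z1 / \<tau> + l / \<tau>) + z1 / \<tau> * (z2 / \<tau>)) =
        - of_real (pi * c) * (\<tau> * t * (l / \<tau> * (cnj l / t) + (z1 / \<tau> + z2 / \<tau>) * (cnj l / t)
           + (cnj z1 / t - cnj z2 / t) * (z1 / \<tau> + l / \<tau>) + z1 / \<tau> * (z2 / \<tau>)))"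
    by (simp only: of_real_mult norm complex_cnj_divide complex_cnj_diff t_def mult_ac mult_minus_left mult_minus_right)
  also have "\<tau> * t * (l / \<tau> * (cnj l / t) + (z1 / \<tau> + z2 / \<tau>) * (cnj l / t)
           + (cnj z1 / t - cnj z2 / t) * (z1 / \<tau> + l / \<tau>) + z1 / \<tau> * (z2 / \<tau>)) =
       l * cnj l + (z1 + z2) * cnj l + (cnj z1 - cnj z2) * (z1 + l) + z1 * z2 - (\<tau> - t) / \<tau> * z1 * z2"
    using t assms by (simp add: field_simps)
  also have "- of_real (pi * c) * \<dots> = 2 * of_real pi * \<i> * of_real (c * Im \<tau>) / \<tau> * z1 * z2 +
      - of_real (pi * c) * (l * cnj l + (z1 + z2) * cnj l + cnj (z1 - z2) * (z1 + l) + z1 * z2)"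
    unfolding Im[symmetric] by (simp add: algebra_simps)
  finally have "lattice_kernel (c * (norm \<tau>)\<^sup>2) (z1 / \<tau>) (z2 / \<tau>) (l / \<tau>) =
     exp (2 * of_real pi * \<i> * of_real (c * Im \<tau>) / \<tau> * z1 * z2) *
     exp (- of_real (pi * c) * (l * cnj l + (z1 + z2) * cnj l + cnj (z1 - z2) * (z1 + l) + z1 * z2)) / ((z1 + l) / \<tau>)"
    unfolding lattice_kernel_def mult_exp_exp by (simp only: add_divide_distrib)
  thus ?thesis by (simp add: lattice_kernel_def)
qed

context
  fixes m :: real and \<tau> z1 z2 :: complex
  assumes m_half: "2 * m \<in> \<int>" and m_pos: "m > 0" and tau: "Im \<tau> > 0"
    and np: "\<And>a b :: int. z1 + (of_int a * \<tau> + of_int b) \<noteq> 0"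
begin

text \<open>The substitution \<open>(a, b)\<close> to \<open>(b, - a)\<close> exchanges the two sign
  characters. Writing both signs as \<open>ee s1\<close> and \<open>ee s\<close> covers the four
  laws of (a) at once; reversed signs in the exponents are invisible because \<open>2 * s\<close>
  and \<open>2 * m\<close> are integers.\<close>

lemma tPhi_inversion:
  fixes s s1 :: real
  assumes s: "2 * s \<in> \<int>" "2 * s1 \<in> \<int>" and \<epsilon>: "\<epsilon> \<in> {1, -1}" "\<epsilon>1 \<in> {1, -1}"
    and "\<epsilon> = ee (of_real s1)" "\<epsilon>1 = ee (of_real s)"
  shows "tPhi \<epsilon> m s (-1 / \<tau>) (z1 / \<tau>) (z2 / \<tau>) =
           \<tau> * exp (2 * of_real pi * \<i> * of_real m / \<tau> * z1 * z2) * tPhi \<epsilon>1 m s1 \<tau> z1 z2"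
proof -
  define K where "K = \<tau> * exp (2 * of_real pi * \<i> * of_real m / \<tau> * z1 * z2)"
  have \<tau>0: "\<tau> \<noteq> 0" using tau by auto
  have Im': "Im (- 1 / \<tau>) = Im \<tau> / (norm \<tau>)\<^sup>2"
    by (simp add: Im_divide cmod_power2)
  have tau': "Im (- 1 / \<tau>) > 0" unfolding Im' using tau \<tau>0 by simp
  have c': "m / Im (- 1 / \<tau>) = m / Im \<tau> * (norm \<tau>)\<^sup>2"
    unfolding Im' using tau \<tau>0 by simp
  have l: "of_int a * (- 1 / \<tau>) + of_int b = (of_int b * \<tau> + of_int (- a)) / \<tau>" for a b :: int
    using \<tau>0 by (simp add: field_simps)
  have np': "z1 / \<tau> + (of_int a * (- 1 / \<tau>) + of_int b) \<noteq> 0" for a b :: int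
    unfolding l using np[of b "-a"] \<tau>0 by (simp flip: add_divide_distrib)
  have "lattice_term \<epsilon> m s (-1 / \<tau>) (z1 / \<tau>) (z2 / \<tau>) a b = K * lattice_term \<epsilon>1 m s1 \<tau> z1 z2 b (- a)" for a b
  proof -
    have kernel: "lattice_kernel (m / Im (- 1 / \<tau>)) (z1 / \<tau>) (z2 / \<tau>) (of_int a * (- 1 / \<tau>) + of_int b) =
        K * lattice_kernel (m / Im \<tau>) z1 z2 (of_int b * \<tau> + of_int (- a))"
      unfolding c' l lattice_kernel_inversion[OF \<tau>0] K_def using tau by simp
    have 1: "\<epsilon> powi a = ee (- of_real s1 * of_int (- a))"
      by (simp add: assms ee_power_int mult.commute)
    have "of_real s * of_int b - - of_real s * of_int b = complex_of_real (2 * s * of_int b)" by simp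
    also have "2 * s * of_int b \<in> \<int>" by (intro Ints_mult s Ints_of_int)
    hence "of_real (2 * s * of_int b) \<in> (\<int> :: complex set)" by (intro Ints_of_real Ints_minus)
    finally have "ee (of_real s * of_int b) = ee (- of_real s * of_int b)" by (rule ee_eqI)
    hence 2: "\<epsilon>1 powi b = ee (- of_real s * of_int b)"
      by (simp add: assms ee_power_int mult.commute)
    have "- of_real m * of_int a * of_int b - - of_real m * of_int b * of_int (- a) = - complex_of_real (2 * m * of_int (a * b))"
      by simp
    also have "2 * m * of_int (a * b) \<in> \<int>" by (intro Ints_mult m_half Ints_of_int)
    hence "- of_real (2 * m * of_int (a * b)) \<in> (\<int> :: complex set)" by (intro Ints_of_real Ints_minus)
    finally have 3: "ee (- of_real m * of_int a * of_int b) = ee (- of_real m * of_int b * of_int (- a))"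
      by (rule ee_eqI)
    show ?thesis
      unfolding lattice_term_def kernel 1 2 3 by (simp only: mult_ac)
  qed
  hence "(\<Sum>\<^sub>\<infinity>(a, b). lattice_term \<epsilon> m s (-1 / \<tau>) (z1 / \<tau>) (z2 / \<tau>) a b) =
         (\<Sum>\<^sub>\<infinity>(a, b). K * lattice_term \<epsilon>1 m s1 \<tau> z1 z2 a b)"
    by (intro infsum_reindex_bij_witness[of _ "\<lambda>(a, b). (- b, a)" "\<lambda>(a, b). (b, - a)"]) auto
  also have "\<dots> = K * (\<Sum>\<^sub>\<infinity>(a, b). lattice_term \<epsilon>1 m s1 \<tau> z1 z2 a b)"
    by (simp add: infsum_cmult_right' case_prod_unfold)
  finally show ?thesis
    unfolding K_def[symmetric] tPhi_eq_lattice_sum[OF m_half m_pos s(1) tau' \<epsilon>(1) np'] tPhi_eq_lattice_sum[OF m_half m_pos s(2) tau \<epsilon>(2) np]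
    by simp
qed

text \<open>Replacing \<open>b\<close> by \<open>a + b\<close> changes the quadratic sign by
  \<open>ee (m a\<^sup>2)\<close>. This equals \<open>ee (m a)\<close>, since
  \<open>a\<^sup>2\<close> and \<open>a\<close> have the same parity and \<open>2 * m\<close> is an
  integer; together with \<open>ee (s a)\<close> it is absorbed into
  \<open>\<epsilon>1\<close>.\<close>

lemma tPhi_translation:
  fixes s :: real
  assumes s: "2 * s \<in> \<int>" and \<epsilon>: "\<epsilon> \<in> {1, -1}" "\<epsilon>1 \<in> {1, -1}" and "\<epsilon>1 = \<epsilon> * ee (of_real (m + s))"
  shows "tPhi \<epsilon> m s (\<tau> + 1) z1 z2 = tPhi \<epsilon>1 m s \<tau> z1 z2"
proof -
  have l: "of_int a * (\<tau> + 1) + of_int b = of_int a * \<tau> + of_int (a + b)" for a b :: int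
    by (simp add: algebra_simps)
  have np': "z1 + (of_int a * (\<tau> + 1) + of_int b) \<noteq> 0" for a b :: int
    unfolding l by (rule np)
  have tau': "Im (\<tau> + 1) > 0" using tau by simp
  have "lattice_term \<epsilon> m s (\<tau> + 1) z1 z2 a b = lattice_term \<epsilon>1 m s \<tau> z1 z2 a (a + b)" for a b
  proof -
    have \<epsilon>1: "\<epsilon>1 powi a = \<epsilon> powi a * ee (of_int a * of_real (m + s))"
      by (simp only: assms power_int_mult_distrib ee_power_int)
    have "even (a * (a - 1))" by auto
    then obtain k where k: "a * (a - 1) = 2 * k" by (elim evenE)
    have "(- of_real s * of_int b + - of_real m * of_int a * of_int b) -
      (of_int a * of_real (m + s) + - of_real s * of_int (a + b) + - of_real m * of_int a * of_int (a + b)) =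
       complex_of_real m * of_int (a * (a - 1))" by (simp add: algebra_simps)
    also have "\<dots> = of_real (2 * m * of_int k)" by (simp add: k)
    also have "2 * m * of_int k \<in> \<int>" by (intro Ints_mult m_half Ints_of_int)
    hence "of_real (2 * m * of_int k) \<in> (\<int> :: complex set)" by (intro Ints_of_real Ints_minus)
    finally have "ee (- of_real s * of_int b) * ee (- of_real m * of_int a * of_int b) =
       ee (of_int a * of_real (m + s)) * ee (- of_real s * of_int (a + b)) * ee (- of_real m * of_int a * of_int (a + b))"
      unfolding ee_add[symmetric] by (rule ee_eqI)
    thus ?thesis unfolding lattice_term_def \<epsilon>1 l by (simp add: mult.assoc)
  qed
  hence "(\<Sum>\<^sub>\<infinity>(a, b). lattice_term \<epsilon> m s (\<tau> + 1) z1 z2 a b) = (\<Sum>\<^sub>\<infinity>(a, b). lattice_term \<epsilon>1 m s \<tau> z1 z2 a b)"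
    by (intro infsum_reindex_bij_witness[of _ "\<lambda>(a, b). (a, b - a)" "\<lambda>(a, b). (a, a + b)"]) auto
  thus ?thesis
    unfolding tPhi_eq_lattice_sum[OF m_half m_pos s(1) tau' \<epsilon>(1) np'] tPhi_eq_lattice_sum[OF m_half m_pos s tau \<epsilon>(2) np]
    by simp
qed

text \<open>After translating the indices, the new phase is affine in \<open>A\<close> and
  \<open>B\<close>. Its coefficient at \<open>A\<close> alters the sign by
  \<open>ee (m (\<alpha>' + \<beta>'))\<close>, its coefficient at \<open>B\<close> alters
  \<open>s\<close> by \<open>m (\<alpha> - \<beta>)\<close> modulo 1, and the constant is the
  elliptic factor.\<close>

lemma tPhi_elliptic:
  fixes s s1 :: real and \<alpha> \<alpha>' \<beta> \<beta>' :: int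
  assumes s: "2 * s \<in> \<int>" "2 * s1 \<in> \<int>" and \<epsilon>: "\<epsilon> \<in> {1, -1}" "\<epsilon>1 \<in> {1, -1}"
    and "\<epsilon>1 = \<epsilon> * ee (of_real (m * of_int (\<alpha>' + \<beta>')))" and s1: "s1 - s + m * of_int (\<alpha> - \<beta>) \<in> \<int>"
  shows "tPhi \<epsilon> m s \<tau> (z1 + (of_int \<alpha> * \<tau> + of_int \<alpha>')) (z2 + (of_int \<beta> * \<tau> + of_int \<beta>')) =
     \<epsilon> powi \<alpha> * ee (of_real s * of_int \<alpha>' - of_real m * of_int \<alpha> * of_int (\<alpha>' + \<beta>'))
       * ee (- of_real m * (of_int \<beta> * z1 + of_int \<alpha> * z2) - of_real m * of_int \<alpha> * of_int \<beta> * \<tau>) * tPhi \<epsilon>1 m s1 \<tau> z1 z2"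
proof -
  define \<mu> \<nu> where "\<mu> = of_int \<alpha> * \<tau> + of_int \<alpha>'" and "\<nu> = of_int \<beta> * \<tau> + of_int \<beta>'"
  define K1 where "K1 = ee (of_real s * of_int \<alpha>' - of_real m * of_int \<alpha> * of_int (\<alpha>' + \<beta>'))"
  define K2 where "K2 = ee (- of_real m * (of_int \<beta> * z1 + of_int \<alpha> * z2) - of_real m * of_int \<alpha> * of_int \<beta> * \<tau>)"
  define c where "c = m / Im \<tau>"
  have np': "z1 + \<mu> + (of_int a * \<tau> + of_int b) \<noteq> 0" for a b :: int
    using np[of "a + \<alpha>" "b + \<alpha>'"] by (simp add: \<mu>_def algebra_simps)
  have "lattice_term \<epsilon> m s \<tau> (z1 + \<mu>) (z2 + \<nu>) a b = \<epsilon> powi \<alpha> * K1 * K2 * lattice_term \<epsilon>1 m s1 \<tau> z1 z2 (a + \<alpha>) (b + \<alpha>')" for a b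
  proof -
    define A B where "A = a + \<alpha>" and "B = b + \<alpha>'"
    define L where "L = of_int A * \<tau> + of_int B"
    define X where "X = of_int \<beta> * of_int B - of_int \<beta>' * of_int A + of_int \<beta> * z1 + of_int \<alpha> * z2 + of_int \<alpha> * \<nu>"
    have l: "of_int a * \<tau> + of_int b = L - \<mu>"
      by (simp add: L_def \<mu>_def A_def B_def algebra_simps)
    have X: "\<nu> * cnj L - cnj \<nu> * L + (\<nu> - cnj \<nu>) * z1 + (\<mu> - cnj \<mu>) * z2 + (\<mu> - cnj \<mu>) * \<nu> = (\<tau> - cnj \<tau>) * X"
      by (simp add: L_def \<mu>_def \<nu>_def X_def algebra_simps)
    \<comment> \<open>The factor \<open>2 * \<i> * Im \<tau>\<close> meets
      \<open>c = m / Im \<tau>\<close>, which turns the real Gaussian prefactor into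
      \<open>ee (- m X)\<close>.\<close>
    have "\<tau> - cnj \<tau> = 2 * \<i> * of_real (Im \<tau>)" by (simp add: complex_eq_iff)
    moreover have "of_real c * of_real (Im \<tau>) = complex_of_real m"
      using tau by (simp add: c_def)
    ultimately have E: "- of_real (pi * c) * ((\<tau> - cnj \<tau>) * X) = 2 * of_real pi * \<i> * (- of_real m * X)"
      by simp
    have kernel: "lattice_kernel c (z1 + \<mu>) (z2 + \<nu>) (of_int a * \<tau> + of_int b) = ee (- of_real m * X) * lattice_kernel c z1 z2 L"
      by (simp only: l lattice_kernel_shift X ee_def E)
    have sign: "\<epsilon> powi a = \<epsilon> powi \<alpha> * \<epsilon> powi A"
      using power_int_sign_diff[OF \<epsilon>(1), of A \<alpha>] by (simp add: A_def)
    have sign1: "\<epsilon>1 powi A = \<epsilon> powi A * ee (of_int A * of_real (m * of_int (\<alpha>' + \<beta>')))"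
      by (simp only: assms power_int_mult_distrib ee_power_int)
    have "- of_real s1 * of_int B - (- of_real s * of_int B + of_real (m * of_int (\<alpha> - \<beta>)) * of_int B)
        = - complex_of_real ((s1 - s + m * of_int (\<alpha> - \<beta>)) * of_int B)" by (simp add: algebra_simps)
    also have "(s1 - s + m * of_int (\<alpha> - \<beta>)) * of_int B \<in> \<int>" by (intro Ints_mult s1 Ints_of_int)
    hence "- complex_of_real ((s1 - s + m * of_int (\<alpha> - \<beta>)) * of_int B) \<in> \<int>" by (intro Ints_of_real Ints_minus)
    finally have s1': "ee (- of_real s1 * of_int B) = ee (- of_real s * of_int B + of_real (m * of_int (\<alpha> - \<beta>)) * of_int B)"
      by (rule ee_eqI)
    have phase: "ee (- of_real s * of_int b) * ee (- of_real m * of_int a * of_int b) * ee (- of_real m * X) =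
        K1 * K2 * ee (of_int A * of_real (m * of_int (\<alpha>' + \<beta>'))) * ee (- of_real s1 * of_int B) * ee (- of_real m * of_int A * of_int B)"
      unfolding s1' K1_def K2_def ee_add[symmetric]
      by (rule arg_cong[of _ _ ee]) (simp add: X_def A_def B_def \<nu>_def algebra_simps)
    have "lattice_term \<epsilon> m s \<tau> (z1 + \<mu>) (z2 + \<nu>) a b = (\<epsilon> powi \<alpha> * \<epsilon> powi A * lattice_kernel c z1 z2 L) *
       (ee (- of_real s * of_int b) * ee (- of_real m * of_int a * of_int b) * ee (- of_real m * X))"
      unfolding lattice_term_def c_def[symmetric] kernel sign by (simp only: mult_ac)
    also have "\<dots> = \<epsilon> powi \<alpha> * K1 * K2 * lattice_term \<epsilon>1 m s1 \<tau> z1 z2 A B"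
      unfolding phase lattice_term_def c_def[symmetric] L_def[symmetric] sign1 by (simp only: mult_ac)
    finally show ?thesis by (simp add: A_def B_def)
  qed
  hence "(\<Sum>\<^sub>\<infinity>(a, b). lattice_term \<epsilon> m s \<tau> (z1 + \<mu>) (z2 + \<nu>) a b) =
         (\<Sum>\<^sub>\<infinity>(a, b). \<epsilon> powi \<alpha> * K1 * K2 * lattice_term \<epsilon>1 m s1 \<tau> z1 z2 a b)"
    by (intro infsum_reindex_bij_witness[of _ "\<lambda>(a, b). (a - \<alpha>, b - \<alpha>')" "\<lambda>(a, b). (a + \<alpha>, b + \<alpha>')"]) auto
  also have "\<dots> = \<epsilon> powi \<alpha> * K1 * K2 * (\<Sum>\<^sub>\<infinity>(a, b). lattice_term \<epsilon>1 m s1 \<tau> z1 z2 a b)"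
    by (simp add: infsum_cmult_right' case_prod_unfold)
  finally show ?thesis
    unfolding \<mu>_def[symmetric] \<nu>_def[symmetric] K1_def[symmetric] K2_def[symmetric]
      tPhi_eq_lattice_sum[OF m_half m_pos s(1) tau \<epsilon>(1) np'] tPhi_eq_lattice_sum[OF m_half m_pos s(2) tau \<epsilon>(2) np]
    by simp
qed

end

section \<open>Half-integers and the assembly of the four parts\<close>

lemma ee_half_odd: "x - 1 / 2 \<in> \<int> \<Longrightarrow> ee (of_real x) = -1"
proof -
  assume "x - 1 / 2 \<in> \<int>"
  hence "of_real (x - 1 / 2) \<in> (\<int> :: complex set)" by (rule Ints_of_real)
  hence "ee (of_real x) = ee (1 / 2)" by (intro ee_eqI) simp
  thus ?thesis by (simp add: ee_def)
qed

lemma ee_of_real_Ints: "x \<in> \<int> \<Longrightarrow> ee (of_real x) = 1"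
  by (intro ee_Ints Ints_of_real)

lemma half_integer_cases:
  fixes x :: real
  assumes "2 * x \<in> \<int>"
  obtains "x \<in> \<int>" | "x - 1 / 2 \<in> \<int>"
proof -
  obtain k :: int where k: "2 * x = of_int k" using assms by (blast elim: Ints_cases)
  show thesis
  proof (cases "even k")
    case True
    then obtain j where "k = 2 * j" by (elim evenE)
    hence "x = of_int j" using k by simp
    thus thesis using that(1) by simp
  next
    case False
    then obtain j where "k = 2 * j + 1" by (elim oddE)
    hence "x - 1 / 2 = of_int j" using k by simp
    thus thesis using that(2) by simp
  qed
qed

lemma half_integer_mult_even:
  fixes m :: real
  assumes "2 * m \<in> \<int>" "even k"
  shows "m * of_int k \<in> \<int>"
proof -
  obtain j where "k = 2 * j" using assms(2) by (elim evenE)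
  hence "m * of_int k = 2 * m * of_int j" by simp
  thus ?thesis using assms(1) by (simp only: Ints_mult Ints_of_int)
qed

lemma half_odd_mult_odd:
  fixes m :: real
  assumes "m - 1 / 2 \<in> \<int>" "odd k"
  shows "m * of_int k - 1 / 2 \<in> \<int>"
proof -
  obtain j where "k = 2 * j + 1" using assms(2) by (elim oddE)
  hence "m * of_int k - 1 / 2 = (m - 1 / 2) * of_int k + of_int j" by (simp add: algebra_simps)
  thus ?thesis using assms(1) by (simp only: Ints_add Ints_mult Ints_of_int)
qed

theorem theorem1p3:
  fixes m :: real and \<tau> z1 z2 :: complex
  assumes m_half: "2 * m \<in> \<int>" and m_pos: "m > 0"
    and tau: "Im \<tau> > 0"
    and nopole: "\<forall>a b :: int. z1 \<noteq> of_int a + of_int b * \<tau>"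
  shows
  \<comment> \<open>(a)\<close>
  "(\<forall>s s1 s' s1'. s \<in> \<int> \<and> s1 \<in> \<int> \<and> s' - 1/2 \<in> \<int> \<and> s1' - 1/2 \<in> \<int> \<longrightarrow>
      tPhi 1 m s (-1/\<tau>) (z1/\<tau>) (z2/\<tau>)
        = \<tau> * exp (2 * pi * \<i> * m / \<tau> * z1 * z2) * tPhi 1 m s1 \<tau> z1 z2
    \<and> tPhi (-1) m s (-1/\<tau>) (z1/\<tau>) (z2/\<tau>)
        = \<tau> * exp (2 * pi * \<i> * m / \<tau> * z1 * z2) * tPhi 1 m s' \<tau> z1 z2
    \<and> tPhi 1 m s' (-1/\<tau>) (z1/\<tau>) (z2/\<tau>)
        = \<tau> * exp (2 * pi * \<i> * m / \<tau> * z1 * z2) * tPhi (-1) m s \<tau> z1 z2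
    \<and> tPhi (-1) m s' (-1/\<tau>) (z1/\<tau>) (z2/\<tau>)
        = \<tau> * exp (2 * pi * \<i> * m / \<tau> * z1 * z2) * tPhi (-1) m s1' \<tau> z1 z2)
   \<and>
  \<comment> \<open>(b)\<close>
   (\<forall>\<epsilon>\<in>{1, -1::complex}. \<forall>s s'. 2 * s \<in> \<int> \<and> 2 * s' \<in> \<int> \<and> m + s \<in> \<int>
         \<and> m + s' - 1/2 \<in> \<int> \<longrightarrow>
      tPhi \<epsilon> m s (\<tau> + 1) z1 z2 = tPhi \<epsilon> m s \<tau> z1 z2
    \<and> tPhi \<epsilon> m s' (\<tau> + 1) z1 z2 = tPhi (-\<epsilon>) m s' \<tau> z1 z2)
   \<and>
  \<comment> \<open>(c)\<close>
   (\<forall>\<epsilon>\<in>{1, -1::complex}. \<forall>s. \<forall>a b :: int. 2 * s \<in> \<int> \<and> (even (a - b) \<or> m \<in> \<int>) \<longrightarrow>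
      tPhi \<epsilon> m s \<tau> (z1 + of_int a * \<tau>) (z2 + of_int b * \<tau>)
        = \<epsilon> powi a * exp (- 2 * pi * \<i> * m * (of_int b * z1 + of_int a * z2))
          * qp \<tau> (- of_real m * of_int a * of_int b) * tPhi \<epsilon> m s \<tau> z1 z2
    \<and> tPhi \<epsilon> m s \<tau> (z1 + of_int a) (z2 + of_int b)
        = exp (2 * pi * \<i> * s * of_int a) * tPhi \<epsilon> m s \<tau> z1 z2)
   \<and>
  \<comment> \<open>(d)\<close>
   (\<forall>\<epsilon>\<in>{1, -1::complex}. \<forall>s. \<forall>a b :: int. m \<notin> \<int> \<and> 2 * s \<in> \<int> \<and> odd (a - b) \<longrightarrow>
      tPhi \<epsilon> m s \<tau> (z1 + of_int a * \<tau>) (z2 + of_int b * \<tau>)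
        = \<epsilon> powi a * exp (- 2 * pi * \<i> * m * (of_int b * z1 + of_int a * z2))
          * qp \<tau> (- of_real m * of_int a * of_int b) * tPhi \<epsilon> m (s + 1/2) \<tau> z1 z2
    \<and> tPhi \<epsilon> m s \<tau> (z1 + of_int a) (z2 + of_int b)
        = exp (2 * pi * \<i> * s * of_int a) * tPhi (-\<epsilon>) m s \<tau> z1 z2)"
proof -
  have np: "z1 + (of_int a * \<tau> + of_int b) \<noteq> 0" for a b :: int
  proof
    assume "z1 + (of_int a * \<tau> + of_int b) = 0"
    hence "z1 = of_int (- b) + of_int (- a) * \<tau>" by (simp add: algebra_simps eq_neg_iff_add_eq_0)
    thus False using nopole by blast
  qed
  note inversion = tPhi_inversion[OF m_half m_pos tau np, of _ _ _ _ z2]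
    and translation = tPhi_translation[OF m_half m_pos tau np, of _ _ _ z2]
    and elliptic = tPhi_elliptic[OF m_half m_pos tau np, of _ _ _ _ _ _ _ _ z2]
  have double_int: "2 * s \<in> \<int>" if "s \<in> \<int>" for s :: real
    using that by (intro Ints_mult) auto
  have double_half: "2 * s \<in> \<int>" if "s - 1 / 2 \<in> \<int>" for s :: real
  proof -
    have "2 * s = 2 * (s - 1 / 2) + 1" by simp
    thus ?thesis using double_int[OF that] by (simp only: Ints_add Ints_1)
  qed
  have sign_neg: "- \<epsilon> \<in> {1, -1}" if "\<epsilon> \<in> {1, -1}" for \<epsilon> :: complex
    using that by auto

  have elliptic_\<tau>: "tPhi \<epsilon> m s \<tau> (z1 + of_int a * \<tau>) (z2 + of_int b * \<tau>)
        = \<epsilon> powi a * exp (- 2 * pi * \<i> * m * (of_int b * z1 + of_int a * z2))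
          * qp \<tau> (- of_real m * of_int a * of_int b) * tPhi \<epsilon> m s1 \<tau> z1 z2"
    if "\<epsilon> \<in> {1, -1}" "2 * s \<in> \<int>" "2 * s1 \<in> \<int>" "s1 - s + m * of_int (a - b) \<in> \<int>"
    for \<epsilon> :: complex and s s1 :: real and a b :: int
  proof -
    have star: "ee (- of_real m * (of_int b * z1 + of_int a * z2) - of_real m * of_int a * of_int b * \<tau>) =
       exp (- 2 * pi * \<i> * m * (of_int b * z1 + of_int a * z2)) * qp \<tau> (- of_real m * of_int a * of_int b)"
      unfolding ee_def qp_def mult_exp_exp by (rule arg_cong[of _ _ exp]) (simp add: algebra_simps)
    have "\<epsilon> = \<epsilon> * ee (of_real (m * of_int (0 + 0)))" by simp
    from elliptic[OF that(2,3,1,1) this that(4), unfolded star] show ?thesis by simp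
  qed
  have elliptic_1: "tPhi \<epsilon> m s \<tau> (z1 + of_int a) (z2 + of_int b) = exp (2 * pi * \<i> * s * of_int a) * tPhi \<epsilon>1 m s \<tau> z1 z2"
    if "\<epsilon> \<in> {1, -1}" "\<epsilon>1 \<in> {1, -1}" "2 * s \<in> \<int>" "\<epsilon>1 = \<epsilon> * ee (of_real (m * of_int (a + b)))"
    for \<epsilon> \<epsilon>1 :: complex and s :: real and a b :: int
  proof -
    have star: "ee (of_real s * of_int a) = exp (2 * pi * \<i> * s * of_int a)"
      by (simp add: ee_def mult_ac)
    have "s - s + m * of_int (0 - 0) \<in> \<int>" by simp
    from elliptic[OF that(3,3,1,2,4) this] show ?thesis by (simp add: star)
  qed

  show ?thesis
  proof (intro conjI allI ballI impI; (elim conjE)?)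
    fix s s1 s' s1' :: real
    assume s: "s \<in> \<int>" "s1 \<in> \<int>" "s' - 1/2 \<in> \<int>" "s1' - 1/2 \<in> \<int>"
    note e = ee_of_real_Ints[OF s(1)] ee_of_real_Ints[OF s(2)] ee_half_odd[OF s(3)] ee_half_odd[OF s(4)]
    note d = double_int[OF s(1)] double_int[OF s(2)] double_half[OF s(3)] double_half[OF s(4)]
    show "tPhi 1 m s (-1/\<tau>) (z1/\<tau>) (z2/\<tau>) = \<tau> * exp (2 * pi * \<i> * m / \<tau> * z1 * z2) * tPhi 1 m s1 \<tau> z1 z2"
      using inversion[OF d(1,2), of 1 1, unfolded e] by simp
    show "tPhi (-1) m s (-1/\<tau>) (z1/\<tau>) (z2/\<tau>) = \<tau> * exp (2 * pi * \<i> * m / \<tau> * z1 * z2) * tPhi 1 m s' \<tau> z1 z2"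
      using inversion[OF d(1,3), of "-1" 1, unfolded e] by simp
    show "tPhi 1 m s' (-1/\<tau>) (z1/\<tau>) (z2/\<tau>) = \<tau> * exp (2 * pi * \<i> * m / \<tau> * z1 * z2) * tPhi (-1) m s \<tau> z1 z2"
      using inversion[OF d(3,1), of 1 "-1", unfolded e] by simp
    show "tPhi (-1) m s' (-1/\<tau>) (z1/\<tau>) (z2/\<tau>) = \<tau> * exp (2 * pi * \<i> * m / \<tau> * z1 * z2) * tPhi (-1) m s1' \<tau> z1 z2"
      using inversion[OF d(3,4), of "-1" "-1", unfolded e] by simp
  next
    fix \<epsilon> :: complex and s s' :: real
    assume \<epsilon>: "\<epsilon> \<in> {1, -1}" and s: "2 * s \<in> \<int>" "2 * s' \<in> \<int>" "m + s \<in> \<int>" "m + s' - 1/2 \<in> \<int>"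
    show "tPhi \<epsilon> m s (\<tau> + 1) z1 z2 = tPhi \<epsilon> m s \<tau> z1 z2"
      using ee_of_real_Ints[OF s(3)] by (intro translation s \<epsilon>) simp
    show "tPhi \<epsilon> m s' (\<tau> + 1) z1 z2 = tPhi (-\<epsilon>) m s' \<tau> z1 z2"
      using ee_half_odd[OF s(4)] by (intro translation s \<epsilon> sign_neg) simp
  next
    fix \<epsilon> :: complex and s :: real and a b :: int
    assume \<epsilon>: "\<epsilon> \<in> {1, -1}" and s: "2 * s \<in> \<int>" and ab: "even (a - b) \<or> m \<in> \<int>"
    \<comment> \<open>Shifts by multiples of \<open>\<tau>\<close> involve \<open>m (a - b)\<close>,
      shifts by integers \<open>m (a + b)\<close>; both factors have the same parity, so one
      hypothesis serves both laws.\<close>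
    have int: "m * of_int (a - b) \<in> \<int>" "m * of_int (a + b) \<in> \<int>"
      using ab half_integer_mult_even[OF m_half, of "a - b"] half_integer_mult_even[OF m_half, of "a + b"]
      by (auto intro: Ints_mult)
    show "tPhi \<epsilon> m s \<tau> (z1 + of_int a * \<tau>) (z2 + of_int b * \<tau>)
        = \<epsilon> powi a * exp (- 2 * pi * \<i> * m * (of_int b * z1 + of_int a * z2))
          * qp \<tau> (- of_real m * of_int a * of_int b) * tPhi \<epsilon> m s \<tau> z1 z2"
      using int(1) by (intro elliptic_\<tau> \<epsilon> s) simp
    show "tPhi \<epsilon> m s \<tau> (z1 + of_int a) (z2 + of_int b) = exp (2 * pi * \<i> * s * of_int a) * tPhi \<epsilon> m s \<tau> z1 z2"
      using ee_of_real_Ints[OF int(2)] by (intro elliptic_1 \<epsilon> s) simp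
  next
    fix \<epsilon> :: complex and s :: real and a b :: int
    assume \<epsilon>: "\<epsilon> \<in> {1, -1}" and m: "m \<notin> \<int>" and s: "2 * s \<in> \<int>" and ab: "odd (a - b)"
    \<comment> \<open>Now \<open>m\<close> is half an odd integer, so \<open>m (a - b)\<close> and
      \<open>m (a + b)\<close> are too: the first moves \<open>s\<close> by 1/2 modulo 1, the second
      flips \<open>\<epsilon>\<close>.\<close>
    have "m - 1 / 2 \<in> \<int>" using half_integer_cases[OF m_half] m by blast
    hence half: "m * of_int (a - b) - 1 / 2 \<in> \<int>" "m * of_int (a + b) - 1 / 2 \<in> \<int>"
      using ab by (auto intro!: half_odd_mult_odd simp del: of_int_diff of_int_add)
    have "2 * (s + 1 / 2) = 2 * s + 1" by simp
    hence s1: "2 * (s + 1 / 2) \<in> \<int>" using s by (simp only: Ints_add Ints_1)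
    have "s + 1 / 2 - s + m * of_int (a - b) = (m * of_int (a - b) - 1 / 2) + 1" by simp
    hence "s + 1 / 2 - s + m * of_int (a - b) \<in> \<int>" using half(1) by (simp only: Ints_add Ints_1)
    thus "tPhi \<epsilon> m s \<tau> (z1 + of_int a * \<tau>) (z2 + of_int b * \<tau>)
        = \<epsilon> powi a * exp (- 2 * pi * \<i> * m * (of_int b * z1 + of_int a * z2))
          * qp \<tau> (- of_real m * of_int a * of_int b) * tPhi \<epsilon> m (s + 1/2) \<tau> z1 z2"
      by (intro elliptic_\<tau> \<epsilon> s s1)
    show "tPhi \<epsilon> m s \<tau> (z1 + of_int a) (z2 + of_int b) = exp (2 * pi * \<i> * s * of_int a) * tPhi (-\<epsilon>) m s \<tau> z1 z2"
      using ee_half_odd[OF half(2)] by (intro elliptic_1 \<epsilon> sign_neg s) simp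
  qed
qed

end
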